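(* Let $Q$ be a commutative unital quantale and let $\alpha\colon X\nrightarrow Y$ and $\beta\colon X'\nrightarrow Y'$ be regular $Q$-relations. Then there is a natural isomorphism (natural in the regular $Q$-relations $\alpha$ and $\beta$, as objects of $\mathbf{D}(Q\text{-}\mathbf{Rel})$) $$\mathfrak{D}\alpha\otimes\mathfrak{D}\beta\;\cong\;\mathfrak{D}(\alpha*\beta)$$ in the category $Q\text{-}\mathbf{Sup}$. In particular, the tensor product $\mathbb{A}\otimes\mathbb{B}$ in $Q\text{-}\mathbf{Sup}$ of two constructively completely distributive (skeletal) cocomplete $Q$-categories $\mathbb{A},\mathbb{B}$ is constructively completely distributive.
   Context: A commutative unital quantale $Q$ is a complete lattice with a commutative associative operation $\&$ with unit $\mathrm{k}$ distributing over arbitrary joins in each variable; $a\to(-)$ is the right adjoint of $a\&(-)$. A $Q$-relation $\alpha\colon X\nrightarrow Y$ is a map $X\times Y\to Q$, ordered pointwise. For $\alpha\colon X\nrightarrow Y$, $\beta\colon Y\nrightarrow Z$, $\gamma\colon X\nrightarrow Z$: $(\beta\circ\alpha)(x,z)=\bigvee_{y}\beta(y,z)\&\alpha(x,y)$, $(\gamma\swarrow\alpha)(y,z)=\bigwedge_{x}\alpha(x,y)\to\gamma(x,z)$, $(\beta\searrow\gamma)(x,y)=\bigwedge_{z}\beta(y,z)\to\gamma(x,z)$. A $Q$-relation $\alpha\colon X\nrightarrow Y$ is regular if $\alpha=\alpha\circ\gamma\circ\alpha$ for some $Q$-relation $\gamma\colon Y\nrightarrow X$. The pointwise tensor product of $\alpha\colon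 X\nrightarrow Y$ and $\beta\colon X'\nrightarrow Y'$ is $\alpha*\beta\colon X\times X'\nrightarrow Y\times Y'$, $(\alpha*\beta)((x,x'),(y,y'))=\alpha(x,y)\&\beta(x',y')$. A $Q$-category $\mathbb{A}$ is a set $\mathbb{A}_0$ with $\mathbb{A}\colon\mathbb{A}_0\times\mathbb{A}_0\to Q$ such that $\mathrm{k}\le\mathbb{A}(x,x)$ and $\mathbb{A}(y,z)\&\mathbb{A}(x,y)\le\mathbb{A}(x,z)$; its underlying preorder is $x\le y\iff\mathrm{k}\le\mathbb{A}(x,y)$, and $\mathbb{A}$ is skeletal if this is a partial order. A $Q$-functor is a map $F$ with $\mathbb{A}(x,y)\le\mathbb{B}(Fx,Fy)$; $F\dashv G$ means $\mathbb{B}(Fx,y)=\mathbb{A}(x,Gy)$. The presheaf $Q$-category $\mathcal{P}\mathbb{A}$ consists of maps $\lambda\colon\mathbb{A}_0\to Q$ with $\lambda(y)\&\mathbb{A}(x,y)\le\lambda(x)$, with $\mathcal{P}\mathbb{A}(\lambda,\mu)=\bigwedge_x\lambda(x)\to\mu(x)$; the Yoneda embedding is $Y_{\mathbb{A}}(x)=\mathbb{A}(-,x)$. $\mathbb{A}$ is cocomplete if $Y_{\mathbb{A}}$ has a left adjoint $S_{\mathbb{A}}$, and constructively completely distributive (ccd) if moreover $S_{\mathbb{A}}$ has a left adjoint $T_{\mathbb{A}}$, i.e. $T_{\mathbb{A}}\dashv S_{\mathbb{A}}\dashv Y_{\mathbb{A}}$. $Q\text{-}\mathbf{Sup}$ is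 the category of skeletal cocomplete $Q$-categories and left adjoint $Q$-functors. Its objects correspond to $Q$-modules, i.e. complete lattices with an action $q\cdot x$ of the monoid $(Q,\&,\mathrm{k})$ preserving joins in each variable, via $\mathbb{A}(x,y)=\bigvee\{q\in Q\mid q\cdot x\le y\}$; morphisms correspond to maps preserving joins and the action. A bimorphism $\mathbb{A}\times\mathbb{B}\to\mathbb{C}$ is a map that is a $Q\text{-}\mathbf{Sup}$-morphism in each variable separately; $\mathbb{A}\otimes\mathbb{B}$ is the object representing bimorphisms out of $\mathbb{A}\times\mathbb{B}$. The diagonal category $\mathbf{D}(Q\text{-}\mathbf{Rel})$ has all $Q$-relations as objects; a morphism from $\alpha\colon X\nrightarrow Y$ to $\beta\colon X'\nrightarrow Y'$ is a $Q$-relation $f\colon X\nrightarrow Y'$ with $(f\swarrow\alpha)\circ\alpha=f=\beta\circ(\beta\searrow f)$ (equivalently, $f=v\circ\alpha=\beta\circ u$ for some $u\colon X\nrightarrow X'$, $v\colon Y\nrightarrow Y'$). The composite of $f\colon\alpha\to\beta$ and $g\colon\beta\to\gamma$ is $g\odot f=g\circ(\beta\searrow f)=(g\swarrow\beta)\circ f$; the identity on $\alpha$ is $\alpha$. Hom-sets carry the pointwise order and the $Q$-action $(q\cdot f)(x,y)=q\& f(x,y)$, making them objects of $Q\text{-}\mathbf{Sup}$. If $f\colon\alpha\to\beta$ and $f'\colon\alpha'\to\beta'$ are morphisms, so is $f*f'\colon\alpha*\alpha'\to\beta*\beta'$. $\star_{\mathrm{k}}\colon\{\star\}\nrightarrow\{\star\}$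 is the $Q$-relation on the singleton with value $\mathrm{k}$. The functor $\mathfrak{D}=\mathbf{D}(Q\text{-}\mathbf{Rel})(-,\star_{\mathrm{k}})\colon\mathbf{D}(Q\text{-}\mathbf{Rel})^{\mathrm{op}}\to Q\text{-}\mathbf{Sup}$ sends $\alpha$ to $\mathfrak{D}\alpha=\mathbf{D}(Q\text{-}\mathbf{Rel})(\alpha,\star_{\mathrm{k}})$ (i.e. the $\mu\colon X\nrightarrow\{\star\}$ with $\mu=(\mu\swarrow\alpha)\circ\alpha$), and $f\colon\beta\to\alpha$ to $\mathfrak{D}f(\lambda)=\lambda\odot f$. $\mathfrak{D}\alpha$ is (isomorphic to) the property-oriented concept lattice of the $Q$-context $(X,Y,\alpha)$. *)

theory Defs
  imports Main "HOL-Library.FuncSet"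
begin

section \<open>Commutative unital quantales\<close>

text \<open>The operation of the quantale is written \<open>*\<close> and its unit \<open>1\<close>.\<close>

class comm_unital_quantale = complete_lattice + comm_monoid_mult +
  assumes mult_Sup_distrib: "a * Sup B = (SUP b\<in>B. a * b)"
begin

definition qimp :: "'a \<Rightarrow> 'a \<Rightarrow> 'a"  (infixr "\<rightharpoonup>" 55)
  where "a \<rightharpoonup> b = Sup {c. a * c \<le> b}"

end


section \<open>Q-relations\<close>

text \<open>
  A Q-relation comes with its domain and codomain, which are subsets of the types \<open>'x\<close> and
  \<open>'y\<close>.  Values outside \<open>src \<times> tgt\<close> are fixed to \<open>undefined\<close>, so that equality on the type
  is equality of Q-relations.
\<close>

typedef ('x, 'y, 'q) qrel =
  "{(X :: 'x set, Y :: 'y set, r :: 'x \<Rightarrow> 'y \<Rightarrow> 'q).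
      \<forall>x y. x \<notin> X \<or> y \<notin> Y \<longrightarrow> r x y = undefined}"
  by (rule exI[of _ "({}, {}, \<lambda>_ _. undefined)"]) simp

definition Qrel :: "'x set \<Rightarrow> 'y set \<Rightarrow> ('x \<Rightarrow> 'y \<Rightarrow> 'q) \<Rightarrow> ('x, 'y, 'q) qrel"
  where "Qrel X Y r = Abs_qrel (X, Y, \<lambda>x y. if x \<in> X \<and> y \<in> Y then r x y else undefined)"

definition src :: "('x, 'y, 'q) qrel \<Rightarrow> 'x set"
  where "src \<alpha> = fst (Rep_qrel \<alpha>)"

definition tgt :: "('x, 'y, 'q) qrel \<Rightarrow> 'y set"
  where "tgt \<alpha> = fst (snd (Rep_qrel \<alpha>))"

definition val :: "('x, 'y, 'q) qrel \<Rightarrow> 'x \<Rightarrow> 'y \<Rightarrow> 'q"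
  where "val \<alpha> = snd (snd (Rep_qrel \<alpha>))"

lemma Rep_Qrel:
  "Rep_qrel (Qrel X Y r) = (X, Y, \<lambda>x y. if x \<in> X \<and> y \<in> Y then r x y else undefined)"
  unfolding Qrel_def by (rule Abs_qrel_inverse) auto

lemma src_Qrel [simp]: "src (Qrel X Y r) = X"
  and tgt_Qrel [simp]: "tgt (Qrel X Y r) = Y"
  and val_Qrel: "val (Qrel X Y r) x y = (if x \<in> X \<and> y \<in> Y then r x y else undefined)"
  by (simp_all add: src_def tgt_def val_def Rep_Qrel)

lemma val_Qrel_in [simp]: "x \<in> X \<Longrightarrow> y \<in> Y \<Longrightarrow> val (Qrel X Y r) x y = r x y"
  by (simp add: val_Qrel)

lemma val_outside: "x \<notin> src \<alpha> \<or> y \<notin> tgt \<alpha> \<Longrightarrow> val \<alpha> x y = undefined"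
  using Rep_qrel[of \<alpha>] by (auto simp: src_def tgt_def val_def)

lemma qrel_eqI:
  assumes "src \<alpha> = src \<beta>" "tgt \<alpha> = tgt \<beta>"
    and "\<And>x y. x \<in> src \<alpha> \<Longrightarrow> y \<in> tgt \<alpha> \<Longrightarrow> val \<alpha> x y = val \<beta> x y"
  shows "\<alpha> = \<beta>"
proof -
  have "val \<alpha> = val \<beta>"
  proof (intro ext)
    fix x y show "val \<alpha> x y = val \<beta> x y"
      using assms val_outside[of x \<alpha> y] val_outside[of x \<beta> y]
      by (cases "x \<in> src \<alpha> \<and> y \<in> tgt \<alpha>") auto
  qed
  then have "Rep_qrel \<alpha> = Rep_qrel \<beta>"
    using assms by (simp add: src_def tgt_def val_def prod_eq_iff)
  then show ?thesis by (simp add: Rep_qrel_inject)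
qed

definition qrel_le :: "('x, 'y, 'q::ord) qrel \<Rightarrow> ('x, 'y, 'q) qrel \<Rightarrow> bool"
  where "qrel_le f g \<longleftrightarrow> src f = src g \<and> tgt f = tgt g \<and>
           (\<forall>x\<in>src f. \<forall>y\<in>tgt f. val f x y \<le> val g x y)"

text \<open>
  \<open>qcomp \<beta> \<alpha>\<close> is \<open>\<beta> \<circ> \<alpha>\<close> (meaningful when \<open>tgt \<alpha> = src \<beta>\<close>), \<open>lresid \<gamma> \<alpha>\<close> is
  \<open>\<gamma> \<swarrow> \<alpha>\<close> (when \<open>src \<alpha> = src \<gamma>\<close>), and \<open>rresid \<beta> \<gamma>\<close> is \<open>\<beta> \<searrow> \<gamma>\<close> (when
  \<open>tgt \<beta> = tgt \<gamma>\<close>).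
\<close>

definition qcomp :: "('y, 'z, 'q::comm_unital_quantale) qrel \<Rightarrow> ('x, 'y, 'q) qrel \<Rightarrow> ('x, 'z, 'q) qrel"
  where "qcomp \<beta> \<alpha> = Qrel (src \<alpha>) (tgt \<beta>) (\<lambda>x z. SUP y\<in>tgt \<alpha>. val \<beta> y z * val \<alpha> x y)"

definition lresid :: "('x, 'z, 'q::comm_unital_quantale) qrel \<Rightarrow> ('x, 'y, 'q) qrel \<Rightarrow> ('y, 'z, 'q) qrel"
  where "lresid \<gamma> \<alpha> = Qrel (tgt \<alpha>) (tgt \<gamma>) (\<lambda>y z. INF x\<in>src \<alpha>. val \<alpha> x y \<rightharpoonup> val \<gamma> x z)"

definition rresid :: "('y, 'z, 'q::comm_unital_quantale) qrel \<Rightarrow> ('x, 'z, 'q) qrel \<Rightarrow> ('x, 'y, 'q) qrel"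
  where "rresid \<beta> \<gamma> = Qrel (src \<gamma>) (src \<beta>) (\<lambda>x y. INF z\<in>tgt \<beta>. val \<beta> y z \<rightharpoonup> val \<gamma> x z)"

definition regular :: "('x, 'y, 'q::comm_unital_quantale) qrel \<Rightarrow> bool"
  where "regular \<alpha> \<longleftrightarrow>
    (\<exists>\<gamma> :: ('y, 'x, 'q) qrel. src \<gamma> = tgt \<alpha> \<and> tgt \<gamma> = src \<alpha> \<and> \<alpha> = qcomp \<alpha> (qcomp \<gamma> \<alpha>))"

definition qprod :: "('x, 'y, 'q::comm_unital_quantale) qrel \<Rightarrow> ('u, 'v, 'q) qrel \<Rightarrow>
    ('x \<times> 'u, 'y \<times> 'v, 'q) qrel"  (infixr "\<circledast>" 70)
  where "\<alpha> \<circledast> \<beta> = Qrel (src \<alpha> \<times> src \<beta>) (tgt \<alpha> \<times> tgt \<beta>)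
           (\<lambda>p p'. val \<alpha> (fst p) (fst p') * val \<beta> (snd p) (snd p'))"

definition qaction :: "'q::comm_unital_quantale \<Rightarrow> ('x, 'y, 'q) qrel \<Rightarrow> ('x, 'y, 'q) qrel"
  where "qaction q f = Qrel (src f) (tgt f) (\<lambda>x y. q * val f x y)"


section \<open>Q-categories and Q-functors\<close>

record ('a, 'q) qcat =
  Obs :: "'a set"
  Hom :: "'a \<Rightarrow> 'a \<Rightarrow> 'q"

definition qcategory :: "('a, 'q::comm_unital_quantale) qcat \<Rightarrow> bool"
  where "qcategory A \<longleftrightarrow>
    (\<forall>x\<in>Obs A. 1 \<le> Hom A x x) \<and>
    (\<forall>x\<in>Obs A. \<forall>y\<in>Obs A. \<forall>z\<in>Obs A. Hom A y z * Hom A x y \<le> Hom A x z)"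

definition skeletal :: "('a, 'q::comm_unital_quantale) qcat \<Rightarrow> bool"
  where "skeletal A \<longleftrightarrow>
    (\<forall>x\<in>Obs A. \<forall>y\<in>Obs A. 1 \<le> Hom A x y \<and> 1 \<le> Hom A y x \<longrightarrow> x = y)"

definition qfunctor :: "('a, 'q::comm_unital_quantale) qcat \<Rightarrow> ('b, 'q) qcat \<Rightarrow> ('a \<Rightarrow> 'b) \<Rightarrow> bool"
  where "qfunctor A B F \<longleftrightarrow> F \<in> Obs A \<rightarrow> Obs B \<and>
    (\<forall>x\<in>Obs A. \<forall>y\<in>Obs A. Hom A x y \<le> Hom B (F x) (F y))"

text \<open>\<open>adjunction A B F G\<close>: the Q-functor \<open>F\<close> from \<open>A\<close> to \<open>B\<close> is left adjoint to \<open>G\<close>.\<close>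

definition adjunction :: "('a, 'q::comm_unital_quantale) qcat \<Rightarrow> ('b, 'q) qcat \<Rightarrow>
    ('a \<Rightarrow> 'b) \<Rightarrow> ('b \<Rightarrow> 'a) \<Rightarrow> bool"
  where "adjunction A B F G \<longleftrightarrow> qfunctor A B F \<and> qfunctor B A G \<and>
    (\<forall>x\<in>Obs A. \<forall>y\<in>Obs B. Hom B (F x) y = Hom A x (G y))"

definition presheaves :: "('a, 'q::comm_unital_quantale) qcat \<Rightarrow> ('a \<Rightarrow> 'q, 'q) qcat"
  where "presheaves A =
    \<lparr>Obs = {l \<in> extensional (Obs A). \<forall>x\<in>Obs A. \<forall>y\<in>Obs A. l y * Hom A x y \<le> l x},
     Hom = (\<lambda>l m. INF x\<in>Obs A. l x \<rightharpoonup> m x)\<rparr>"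

definition yoneda :: "('a, 'q::comm_unital_quantale) qcat \<Rightarrow> 'a \<Rightarrow> 'a \<Rightarrow> 'q"
  where "yoneda A x = (\<lambda>y\<in>Obs A. Hom A y x)"

definition cocomplete :: "('a, 'q::comm_unital_quantale) qcat \<Rightarrow> bool"
  where "cocomplete A \<longleftrightarrow> qcategory A \<and> (\<exists>S. adjunction (presheaves A) A S (yoneda A))"

definition ccd :: "('a, 'q::comm_unital_quantale) qcat \<Rightarrow> bool"
  where "ccd A \<longleftrightarrow> qcategory A \<and>
    (\<exists>S T. adjunction (presheaves A) A S (yoneda A) \<and> adjunction A (presheaves A) T S)"


section \<open>The category Q-Sup and its tensor product\<close>

definition qsup_object :: "('a, 'q::comm_unital_quantale) qcat \<Rightarrow> bool"
  where "qsup_object A \<longleftrightarrow> qcategory A \<and> skeletal A \<and> cocomplete A"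

definition qsup_mor :: "('a, 'q::comm_unital_quantale) qcat \<Rightarrow> ('b, 'q) qcat \<Rightarrow> ('a \<Rightarrow> 'b) \<Rightarrow> bool"
  where "qsup_mor A B F \<longleftrightarrow> qsup_object A \<and> qsup_object B \<and> (\<exists>G. adjunction A B F G)"

definition qsup_iso :: "('a, 'q::comm_unital_quantale) qcat \<Rightarrow> ('b, 'q) qcat \<Rightarrow> ('a \<Rightarrow> 'b) \<Rightarrow> bool"
  where "qsup_iso A B F \<longleftrightarrow> qsup_mor A B F \<and>
    (\<exists>G. qsup_mor B A G \<and> (\<forall>x\<in>Obs A. G (F x) = x) \<and> (\<forall>y\<in>Obs B. F (G y) = y))"

definition bimorphism :: "('a, 'q::comm_unital_quantale) qcat \<Rightarrow> ('b, 'q) qcat \<Rightarrow> ('c, 'q) qcat \<Rightarrow>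
    ('a \<Rightarrow> 'b \<Rightarrow> 'c) \<Rightarrow> bool"
  where "bimorphism A B C h \<longleftrightarrow>
    (\<forall>b\<in>Obs B. qsup_mor A C (\<lambda>a. h a b)) \<and> (\<forall>a\<in>Obs A. qsup_mor B C (h a))"

text \<open>
  \<open>(T, t)\<close> represents the bimorphisms out of \<open>A \<times> B\<close> into Q-categories on the type \<open>'c\<close>; the
  tensor product has this property for every \<open>'c\<close> (\<open>qtensor_represents\<close> below).
\<close>

definition represents_bimorphisms :: "'c itself \<Rightarrow> ('a, 'q::comm_unital_quantale) qcat \<Rightarrow>
    ('b, 'q) qcat \<Rightarrow> ('t, 'q) qcat \<Rightarrow> ('a \<Rightarrow> 'b \<Rightarrow> 't) \<Rightarrow> bool"
  where "represents_bimorphisms (_ :: 'c itself) A B T t \<longleftrightarrow> bimorphism A B T t \<and>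
    (\<forall>(C :: ('c, 'q) qcat) h. bimorphism A B C h \<longrightarrow>
      (\<exists>!H. H \<in> extensional (Obs T) \<and> qsup_mor T C H \<and>
            (\<forall>a\<in>Obs A. \<forall>b\<in>Obs B. H (t a b) = h a b)))"

text \<open>
  HOL cannot quantify over types inside a definition, so the representing object is given by a
  model, and the universal property is proved.  The elements of the model are the maps
  \<open>A \<times> B \<rightarrow> Q\<close> that are representable in each variable; they are exactly the maps
  \<open>(a, b) \<mapsto> Hom C (h a b) c\<close> for bimorphisms \<open>h\<close> into some \<open>C\<close> and \<open>c\<close> in \<open>C\<close>.
  The pure tensor of \<open>a\<close> and \<open>b\<close> is the element \<open>t\<close> with \<open>Hom t \<phi> = \<phi> (a, b)\<close>.
\<close>

definition qtensor :: "('a, 'q::comm_unital_quantale) qcat \<Rightarrow> ('b, 'q) qcat \<Rightarrow> ('a \<times> 'b \<Rightarrow> 'q, 'q) qcat"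
  where "qtensor A B =
    \<lparr>Obs = {\<phi> \<in> extensional (Obs A \<times> Obs B).
              (\<forall>b\<in>Obs B. \<exists>a'\<in>Obs A. \<forall>a\<in>Obs A. \<phi> (a, b) = Hom A a a') \<and>
              (\<forall>a\<in>Obs A. \<exists>b'\<in>Obs B. \<forall>b\<in>Obs B. \<phi> (a, b) = Hom B b b')},
     Hom = (\<lambda>\<phi> \<psi>. INF p\<in>Obs A \<times> Obs B. \<phi> p \<rightharpoonup> \<psi> p)\<rparr>"

definition pure_tensor :: "('a, 'q::comm_unital_quantale) qcat \<Rightarrow> ('b, 'q) qcat \<Rightarrow>
    'a \<Rightarrow> 'b \<Rightarrow> 'a \<times> 'b \<Rightarrow> 'q"
  where "pure_tensor A B a b =
    (\<lambda>p\<in>Obs A \<times> Obs B. INF \<phi>\<in>Obs (qtensor A B). \<phi> (a, b) \<rightharpoonup> \<phi> p)"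

text \<open>The action of the tensor product on morphisms \<open>F : A \<rightarrow> A'\<close> and \<open>G : B \<rightarrow> B'\<close>.\<close>

definition qtensor_map :: "('a, 'q::comm_unital_quantale) qcat \<Rightarrow> ('b, 'q) qcat \<Rightarrow>
    ('c, 'q) qcat \<Rightarrow> ('d, 'q) qcat \<Rightarrow> ('a \<Rightarrow> 'c) \<Rightarrow> ('b \<Rightarrow> 'd) \<Rightarrow>
    ('a \<times> 'b \<Rightarrow> 'q) \<Rightarrow> ('c \<times> 'd \<Rightarrow> 'q)"
  where "qtensor_map A B A' B' F G =
    (THE H. H \<in> extensional (Obs (qtensor A B)) \<and> qsup_mor (qtensor A B) (qtensor A' B') H \<and>
       (\<forall>a\<in>Obs A. \<forall>b\<in>Obs B. H (pure_tensor A B a b) = pure_tensor A' B' (F a) (G b)))"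


section \<open>The diagonal category and the functor D\<close>

definition dmor :: "('x, 'v, 'q::comm_unital_quantale) qrel \<Rightarrow> ('x, 'y, 'q) qrel \<Rightarrow>
    ('u, 'v, 'q) qrel \<Rightarrow> bool"
  where "dmor f \<alpha> \<beta> \<longleftrightarrow> src f = src \<alpha> \<and> tgt f = tgt \<beta> \<and>
    qcomp (lresid f \<alpha>) \<alpha> = f \<and> qcomp \<beta> (rresid \<beta> f) = f"

text \<open>\<open>dcomp \<beta> g f\<close> is the composite of \<open>f : \<alpha> \<rightarrow> \<beta>\<close> and \<open>g : \<beta> \<rightarrow> \<gamma>\<close>.\<close>

definition dcomp :: "('u, 'v, 'q::comm_unital_quantale) qrel \<Rightarrow> ('u, 'w, 'q) qrel \<Rightarrow>
    ('x, 'v, 'q) qrel \<Rightarrow> ('x, 'w, 'q) qrel"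
  where "dcomp \<beta> g f = qcomp g (rresid \<beta> f)"

text \<open>
  The hom-set of morphisms from \<open>\<alpha>\<close> to \<open>\<beta>\<close>, as the Q-category that corresponds to the Q-module
  given by the pointwise order and the pointwise action.
\<close>

definition dhom :: "('x, 'y, 'q::comm_unital_quantale) qrel \<Rightarrow> ('u, 'v, 'q) qrel \<Rightarrow>
    (('x, 'v, 'q) qrel, 'q) qcat"
  where "dhom \<alpha> \<beta> =
    \<lparr>Obs = {f. dmor f \<alpha> \<beta>}, Hom = (\<lambda>f g. Sup {q. qrel_le (qaction q f) g})\<rparr>"

definition star_k :: "(unit, unit, 'q::comm_unital_quantale) qrel"
  where "star_k = Qrel {()} {()} (\<lambda>_ _. 1)"

definition Dobj :: "('x, 'y, 'q::comm_unital_quantale) qrel \<Rightarrow> (('x, unit, 'q) qrel, 'q) qcat"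
  where "Dobj \<alpha> = dhom \<alpha> star_k"

text \<open>For \<open>f : \<beta> \<rightarrow> \<alpha>\<close>, \<open>Dmap \<alpha> f\<close> is the map \<open>Dobj \<alpha> \<rightarrow> Dobj \<beta>\<close> of precomposition with \<open>f\<close>.\<close>

definition Dmap :: "('x, 'y, 'q::comm_unital_quantale) qrel \<Rightarrow> ('u, 'y, 'q) qrel \<Rightarrow>
    ('x, unit, 'q) qrel \<Rightarrow> ('u, unit, 'q) qrel"
  where "Dmap \<alpha> f l = dcomp \<alpha> l f"


section \<open>The universal property of the tensor product\<close>

lemma q_mult_mono_right: "b \<le> c \<Longrightarrow> a * b \<le> a * (c::'q::comm_unital_quantale)"
proof -
  assume "b \<le> c"
  then have "a * c = a * Sup {b, c}" by (simp add: sup_absorb2)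
  also have "\<dots> = sup (a * b) (a * c)" unfolding mult_Sup_distrib by simp
  finally show ?thesis by (metis sup_ge1)
qed

lemma q_mult_mono: "a \<le> a' \<Longrightarrow> b \<le> b' \<Longrightarrow> a * b \<le> a' * (b'::'q::comm_unital_quantale)"
  by (metis mult.commute order_trans q_mult_mono_right)

lemma le_qimp_iff: "c \<le> (a \<rightharpoonup> b) \<longleftrightarrow> a * c \<le> (b::'q::comm_unital_quantale)"
proof
  assume "c \<le> (a \<rightharpoonup> b)"
  then have "a * c \<le> a * Sup {c. a * c \<le> b}" unfolding qimp_def by (rule q_mult_mono_right)
  also have "\<dots> \<le> b" unfolding mult_Sup_distrib by (auto intro: SUP_least)
  finally show "a * c \<le> b" .
next
  assume "a * c \<le> b" then show "c \<le> (a \<rightharpoonup> b)" unfolding qimp_def by (auto intro: Sup_upper)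
qed

lemma le_INF_qimp_iff:
  "c \<le> (INF i\<in>I. f i \<rightharpoonup> g i) \<longleftrightarrow> (\<forall>i\<in>I. f i * c \<le> (g i::'q::comm_unital_quantale))"
  by (simp add: le_INF_iff le_qimp_iff)

lemma mult_SUP_le_iff:
  "a * (SUP i\<in>I. f i) \<le> c \<longleftrightarrow> (\<forall>i\<in>I. a * f i \<le> (c::'q::comm_unital_quantale))"
  by (simp add: mult_Sup_distrib image_image SUP_le_iff)

lemma INF_qimp_mult: "i \<in> I \<Longrightarrow> f i * (INF i\<in>I. f i \<rightharpoonup> g i) \<le> (g i::'q::comm_unital_quantale)"
  using le_INF_qimp_iff[of "INF i\<in>I. f i \<rightharpoonup> g i" f g I] by simp

lemma qcat_refl: "qcategory A \<Longrightarrow> x \<in> Obs A \<Longrightarrow> 1 \<le> Hom A x x"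
  by (simp add: qcategory_def)

lemma qcat_trans:
  "qcategory A \<Longrightarrow> x \<in> Obs A \<Longrightarrow> y \<in> Obs A \<Longrightarrow> z \<in> Obs A \<Longrightarrow> Hom A y z * Hom A x y \<le> Hom A x z"
  by (simp add: qcategory_def)

lemma skeletal_eqI:
  assumes "qcategory A" "skeletal A" "x \<in> Obs A" "y \<in> Obs A"
    and "\<And>z. z \<in> Obs A \<Longrightarrow> Hom A x z = Hom A y z"
  shows "x = y"
  using assms unfolding skeletal_def by (metis qcat_refl)

lemma adjunctionI:
  assumes A: "qcategory A" and B: "qcategory B"
    and F: "F \<in> Obs A \<rightarrow> Obs B" and G: "G \<in> Obs B \<rightarrow> Obs A"
    and eq: "\<And>x y. x \<in> Obs A \<Longrightarrow> y \<in> Obs B \<Longrightarrow> Hom B (F x) y = Hom A x (G y)"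
  shows "adjunction A B F G"
proof -
  have "Hom A x x' \<le> Hom B (F x) (F x')" if x: "x \<in> Obs A" and x': "x' \<in> Obs A" for x x'
  proof -
    have Fx: "F x \<in> Obs B" "F x' \<in> Obs B" using F x x' by auto
    then have GF: "G (F x') \<in> Obs A" using G by auto
    have "1 \<le> Hom A x' (G (F x'))" using eq[OF x' Fx(2)] qcat_refl[OF B Fx(2)] by simp
    then have "Hom A x x' \<le> Hom A x' (G (F x')) * Hom A x x'"
      using q_mult_mono[OF _ order_refl] by fastforce
    also have "\<dots> \<le> Hom A x (G (F x'))" by (rule qcat_trans[OF A x x' GF])
    finally show ?thesis using eq[OF x Fx(2)] by simp
  qed
  moreover have "Hom B y y' \<le> Hom A (G y) (G y')" if y: "y \<in> Obs B" and y': "y' \<in> Obs B" for y y'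
  proof -
    have Gy: "G y \<in> Obs A" "G y' \<in> Obs A" using G y y' by auto
    then have FG: "F (G y) \<in> Obs B" using F by auto
    have "1 \<le> Hom B (F (G y)) y" using eq[OF Gy(1) y] qcat_refl[OF A Gy(1)] by simp
    then have "Hom B y y' \<le> Hom B y y' * Hom B (F (G y)) y"
      using q_mult_mono[OF order_refl] by fastforce
    also have "\<dots> \<le> Hom B (F (G y)) y'" by (rule qcat_trans[OF B FG y y'])
    finally show ?thesis using eq[OF Gy(1) y'] by simp
  qed
  ultimately show ?thesis using assms by (simp add: adjunction_def qfunctor_def)
qed

lemma qcategory_presheaves: "qcategory (presheaves A)"
  unfolding qcategory_def presheaves_def
proof (simp, intro conjI allI impI)
  show "1 \<le> (INF xa\<in>Obs A. x xa \<rightharpoonup> x xa)" for x by (simp add: le_INF_qimp_iff)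
  fix x y z :: "'a \<Rightarrow> 'b"
  have "x i * ((INF i\<in>Obs A. y i \<rightharpoonup> z i) * (INF i\<in>Obs A. x i \<rightharpoonup> y i)) \<le> z i" if "i \<in> Obs A" for i
  proof -
    have "x i * ((INF i\<in>Obs A. y i \<rightharpoonup> z i) * (INF i\<in>Obs A. x i \<rightharpoonup> y i))
        = (x i * (INF i\<in>Obs A. x i \<rightharpoonup> y i)) * (INF i\<in>Obs A. y i \<rightharpoonup> z i)"
      by (simp add: ac_simps)
    also have "\<dots> \<le> y i * (INF i\<in>Obs A. y i \<rightharpoonup> z i)"
      by (intro q_mult_mono INF_qimp_mult that order_refl)
    also have "\<dots> \<le> z i" by (rule INF_qimp_mult[OF that])
    finally show ?thesis .
  qed
  then have "(INF i\<in>Obs A. y i \<rightharpoonup> z i) * (INF i\<in>Obs A. x i \<rightharpoonup> y i) \<le> (INF i\<in>Obs A. x i \<rightharpoonup> z i)"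
    by (simp add: le_INF_qimp_iff)
  then show "x \<in> extensional (Obs A) \<and> (\<forall>xa\<in>Obs A. \<forall>y\<in>Obs A. x y * Hom A xa y \<le> x xa) \<Longrightarrow>
       y \<in> extensional (Obs A) \<and> (\<forall>x\<in>Obs A. \<forall>ya\<in>Obs A. y ya * Hom A x ya \<le> y x) \<Longrightarrow>
       z \<in> extensional (Obs A) \<and> (\<forall>x\<in>Obs A. \<forall>y\<in>Obs A. z y * Hom A x y \<le> z x) \<Longrightarrow>
       (INF i\<in>Obs A. y i \<rightharpoonup> z i) * (INF i\<in>Obs A. x i \<rightharpoonup> y i) \<le> (INF i\<in>Obs A. x i \<rightharpoonup> z i)" .
qed

lemma qcategory_qtensor: "qcategory (qtensor A B)"
proof -
  have "1 \<le> Hom (qtensor A B) x x" for x by (simp add: qtensor_def le_INF_qimp_iff)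
  moreover have "Hom (qtensor A B) y z * Hom (qtensor A B) x y \<le> Hom (qtensor A B) x z" for x y z
  proof -
    let ?I = "Obs A \<times> Obs B"
    have "x i * ((INF i\<in>?I. y i \<rightharpoonup> z i) * (INF i\<in>?I. x i \<rightharpoonup> y i)) \<le> z i" if "i \<in> ?I" for i
    proof -
      have "x i * ((INF i\<in>?I. y i \<rightharpoonup> z i) * (INF i\<in>?I. x i \<rightharpoonup> y i))
          = (x i * (INF i\<in>?I. x i \<rightharpoonup> y i)) * (INF i\<in>?I. y i \<rightharpoonup> z i)"
        by (simp add: ac_simps)
      also have "\<dots> \<le> y i * (INF i\<in>?I. y i \<rightharpoonup> z i)"
        by (intro q_mult_mono INF_qimp_mult that order_refl)
      also have "\<dots> \<le> z i" by (rule INF_qimp_mult[OF that])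
      finally show ?thesis .
    qed
    then show ?thesis by (simp add: qtensor_def le_INF_qimp_iff)
  qed
  ultimately show ?thesis by (simp add: qcategory_def)
qed

lemma yoneda_in: "qcategory A \<Longrightarrow> x \<in> Obs A \<Longrightarrow> yoneda A x \<in> Obs (presheaves A)"
  by (auto simp: yoneda_def presheaves_def qcategory_def)

lemma qsup_weighted_limit:
  assumes "qsup_object A" and c: "\<And>i. i \<in> I \<Longrightarrow> c i \<in> Obs A"
  shows "\<exists>l\<in>Obs A. \<forall>a\<in>Obs A. Hom A a l = (INF i\<in>I. w i \<rightharpoonup> Hom A a (c i))"
proof -
  from assms obtain S where A: "qcategory A" and S: "adjunction (presheaves A) A S (yoneda A)"
    by (auto simp: qsup_object_def cocomplete_def)
  define L where "L = (\<lambda>a\<in>Obs A. INF i\<in>I. w i \<rightharpoonup> Hom A a (c i))"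
  have L: "L \<in> Obs (presheaves A)"
  proof -
    have "L y * Hom A x y \<le> L x" if x: "x \<in> Obs A" and y: "y \<in> Obs A" for x y
    proof -
      have "w i * (L y * Hom A x y) \<le> Hom A x (c i)" if i: "i \<in> I" for i
      proof -
        have "w i * L y \<le> Hom A y (c i)" using y INF_qimp_mult[OF i, of w] by (simp add: L_def)
        then have "w i * (L y * Hom A x y) \<le> Hom A y (c i) * Hom A x y"
          by (simp add: mult.assoc[symmetric] q_mult_mono)
        also have "\<dots> \<le> Hom A x (c i)" by (rule qcat_trans[OF A x y c[OF i]])
        finally show ?thesis .
      qed
      then show ?thesis using x by (simp add: L_def le_INF_qimp_iff)
    qed
    then show ?thesis by (simp add: presheaves_def L_def)
  qed
  have SL: "S L \<in> Obs A" using S L by (auto simp: adjunction_def qfunctor_def)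
  have Seq: "Hom A (S L) y = (INF x\<in>Obs A. L x \<rightharpoonup> Hom A x y)" if "y \<in> Obs A" for y
    using S L that by (auto simp: adjunction_def presheaves_def yoneda_def cong: INF_cong)
  have "Hom A a (S L) = (INF i\<in>I. w i \<rightharpoonup> Hom A a (c i))" if a: "a \<in> Obs A" for a
  proof (rule antisym)
    have "w i * Hom A a (S L) \<le> Hom A a (c i)" if i: "i \<in> I" for i
    proof -
      have "L x * w i \<le> Hom A x (c i)" if x: "x \<in> Obs A" for x
        using x INF_qimp_mult[OF i, of w] by (simp add: L_def mult.commute)
      then have "w i \<le> Hom A (S L) (c i)" using Seq[OF c[OF i]] by (simp add: le_INF_qimp_iff)
      then have "w i * Hom A a (S L) \<le> Hom A (S L) (c i) * Hom A a (S L)" by (simp add: q_mult_mono)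
      also have "\<dots> \<le> Hom A a (c i)" by (rule qcat_trans[OF A a SL c[OF i]])
      finally show ?thesis .
    qed
    then show "Hom A a (S L) \<le> (INF i\<in>I. w i \<rightharpoonup> Hom A a (c i))" by (simp add: le_INF_qimp_iff)
    have "1 \<le> (INF x\<in>Obs A. L x \<rightharpoonup> Hom A x (S L))" using qcat_refl[OF A SL] Seq[OF SL] by simp
    then have "L a \<le> Hom A a (S L)" using a by (simp add: le_INF_qimp_iff)
    then show "(INF i\<in>I. w i \<rightharpoonup> Hom A a (c i)) \<le> Hom A a (S L)" using a by (simp add: L_def)
  qed
  then show ?thesis using SL by blast
qed

lemma qsup_weighted_colimit:
  assumes "qsup_object A" and c: "\<And>i. i \<in> I \<Longrightarrow> c i \<in> Obs A"
  shows "\<exists>l\<in>Obs A. \<forall>a\<in>Obs A. Hom A l a = (INF i\<in>I. w i \<rightharpoonup> Hom A (c i) a)"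
proof -
  from assms obtain S where A: "qcategory A" and S: "adjunction (presheaves A) A S (yoneda A)"
    by (auto simp: qsup_object_def cocomplete_def)
  define L where "L = (\<lambda>a\<in>Obs A. SUP i\<in>I. w i * Hom A a (c i))"
  have L: "L \<in> Obs (presheaves A)"
  proof -
    have "L y * Hom A x y \<le> L x" if x: "x \<in> Obs A" and y: "y \<in> Obs A" for x y
    proof -
      have "Hom A x y * (w i * Hom A y (c i)) \<le> L x" if i: "i \<in> I" for i
      proof -
        have "Hom A x y * (w i * Hom A y (c i)) = w i * (Hom A y (c i) * Hom A x y)"
          by (simp add: ac_simps)
        also have "\<dots> \<le> w i * Hom A x (c i)"
          by (rule q_mult_mono_right[OF qcat_trans[OF A x y c[OF i]]])
        also have "\<dots> \<le> L x" using x i by (auto simp: L_def intro: SUP_upper)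
        finally show ?thesis .
      qed
      then have "Hom A x y * L y \<le> L x" using y by (simp add: L_def[THEN fun_cong, of y] mult_SUP_le_iff)
      then show ?thesis by (simp add: mult.commute)
    qed
    then show ?thesis by (simp add: presheaves_def L_def)
  qed
  have SL: "S L \<in> Obs A" using S L by (auto simp: adjunction_def qfunctor_def)
  have Seq: "Hom A (S L) y = (INF x\<in>Obs A. L x \<rightharpoonup> Hom A x y)" if "y \<in> Obs A" for y
    using S L that by (auto simp: adjunction_def presheaves_def yoneda_def cong: INF_cong)
  have "Hom A (S L) a = (INF i\<in>I. w i \<rightharpoonup> Hom A (c i) a)" if a: "a \<in> Obs A" for a
  proof (rule antisym)
    have "w i * Hom A (S L) a \<le> Hom A (c i) a" if i: "i \<in> I" for i
    proof -
      have "w i * 1 \<le> w i * Hom A (c i) (c i)"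
        by (rule q_mult_mono_right[OF qcat_refl[OF A c[OF i]]])
      also have "\<dots> \<le> L (c i)" using c[OF i] i by (auto simp: L_def intro: SUP_upper)
      finally have "w i * Hom A (S L) a \<le> L (c i) * Hom A (S L) a" by (simp add: q_mult_mono)
      also have "\<dots> \<le> Hom A (c i) a" unfolding Seq[OF a] by (rule INF_qimp_mult[OF c[OF i]])
      finally show ?thesis .
    qed
    then show "Hom A (S L) a \<le> (INF i\<in>I. w i \<rightharpoonup> Hom A (c i) a)" by (simp add: le_INF_qimp_iff)
    let ?r = "INF i\<in>I. w i \<rightharpoonup> Hom A (c i) a"
    have "L x * ?r \<le> Hom A x a" if x: "x \<in> Obs A" for x
    proof -
      have "?r * (w i * Hom A x (c i)) \<le> Hom A x a" if i: "i \<in> I" for i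
      proof -
        have "?r * (w i * Hom A x (c i)) = (w i * ?r) * Hom A x (c i)" by (simp add: ac_simps)
        also have "\<dots> \<le> Hom A (c i) a * Hom A x (c i)"
          by (rule q_mult_mono[OF INF_qimp_mult[OF i, of w] order_refl])
        also have "\<dots> \<le> Hom A x a" by (rule qcat_trans[OF A x c[OF i] a])
        finally show ?thesis .
      qed
      then have "?r * L x \<le> Hom A x a" using x by (simp add: L_def mult_SUP_le_iff)
      then show ?thesis by (simp add: mult.commute)
    qed
    then show "?r \<le> Hom A (S L) a" by (simp add: Seq[OF a] le_INF_qimp_iff)
  qed
  then show ?thesis using SL by blast
qed

lemma qtensor_limit:
  assumes A: "qsup_object A" and B: "qsup_object B"
    and c: "\<And>i. i \<in> I \<Longrightarrow> c i \<in> Obs (qtensor A B)"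
  shows "(\<lambda>p\<in>Obs A \<times> Obs B. INF i\<in>I. w i \<rightharpoonup> c i p) \<in> Obs (qtensor A B)"
proof -
  let ?l = "\<lambda>p\<in>Obs A \<times> Obs B. INF i\<in>I. w i \<rightharpoonup> c i p"
  have "\<exists>a'\<in>Obs A. \<forall>a\<in>Obs A. ?l (a, b) = Hom A a a'" if b: "b \<in> Obs B" for b
  proof -
    have "\<forall>i\<in>I. \<exists>a'\<in>Obs A. \<forall>a\<in>Obs A. c i (a, b) = Hom A a a'"
      using c b by (auto simp: qtensor_def)
    then obtain r where r: "\<And>i. i \<in> I \<Longrightarrow> r i \<in> Obs A"
      "\<And>i a. i \<in> I \<Longrightarrow> a \<in> Obs A \<Longrightarrow> c i (a, b) = Hom A a (r i)" by metis
    obtain l where "l \<in> Obs A" "\<forall>a\<in>Obs A. Hom A a l = (INF i\<in>I. w i \<rightharpoonup> Hom A a (r i))"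
      using qsup_weighted_limit[OF A, of I r w] r(1) by auto
    then show ?thesis using r(2) b by (intro bexI[of _ l]) (auto cong: INF_cong)
  qed
  moreover have "\<exists>b'\<in>Obs B. \<forall>b\<in>Obs B. ?l (a, b) = Hom B b b'" if a: "a \<in> Obs A" for a
  proof -
    have "\<forall>i\<in>I. \<exists>b'\<in>Obs B. \<forall>b\<in>Obs B. c i (a, b) = Hom B b b'"
      using c a by (auto simp: qtensor_def)
    then obtain r where r: "\<And>i. i \<in> I \<Longrightarrow> r i \<in> Obs B"
      "\<And>i b. i \<in> I \<Longrightarrow> b \<in> Obs B \<Longrightarrow> c i (a, b) = Hom B b (r i)" by metis
    obtain l where "l \<in> Obs B" "\<forall>b\<in>Obs B. Hom B b l = (INF i\<in>I. w i \<rightharpoonup> Hom B b (r i))"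
      using qsup_weighted_limit[OF B, of I r w] r(1) by auto
    then show ?thesis using r(2) a by (intro bexI[of _ l]) (auto cong: INF_cong)
  qed
  ultimately show ?thesis by (simp add: qtensor_def)
qed

lemma skeletal_qtensor: "skeletal (qtensor A B)"
  unfolding skeletal_def
proof (intro ballI impI)
  fix x y assume x: "x \<in> Obs (qtensor A B)" and y: "y \<in> Obs (qtensor A B)"
    and le: "1 \<le> Hom (qtensor A B) x y \<and> 1 \<le> Hom (qtensor A B) y x"
  then have "x p = y p" if "p \<in> Obs A \<times> Obs B" for p
    using that by (auto simp: qtensor_def le_INF_qimp_iff intro: antisym)
  then show "x = y" using x y by (auto simp: qtensor_def intro: extensionalityI)
qed

lemma qsup_object_qtensor:
  assumes A: "qsup_object A" and B: "qsup_object B"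
  shows "qsup_object (qtensor A B)"
proof -
  let ?T = "qtensor A B" and ?I = "Obs A \<times> Obs B"
  define W where "W L \<psi> = (INF \<phi>\<in>Obs ?T. L \<phi> \<rightharpoonup> Hom ?T \<phi> \<psi>)" for L \<psi>
  define S where "S L = (\<lambda>p\<in>?I. INF \<psi>\<in>Obs ?T. W L \<psi> \<rightharpoonup> \<psi> p)" for L
  have S: "S L \<in> Obs ?T" for L unfolding S_def by (rule qtensor_limit[OF A B])
  have "Hom ?T (S L) \<psi> = W L \<psi>" if \<psi>: "\<psi> \<in> Obs ?T" for L \<psi>
  proof (rule antisym)
    have "S L p * W L \<psi> \<le> \<psi> p" if "p \<in> ?I" for p
      using that INF_qimp_mult[OF \<psi>, of "W L" "\<lambda>\<psi>. \<psi> p"] by (simp add: S_def mult.commute)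
    then show "W L \<psi> \<le> Hom ?T (S L) \<psi>" by (simp add: qtensor_def le_INF_qimp_iff)
    have "L \<phi> * Hom ?T (S L) \<psi> \<le> Hom ?T \<phi> \<psi>" if \<phi>: "\<phi> \<in> Obs ?T" for \<phi>
    proof -
      have "\<phi> p * L \<phi> \<le> S L p" if p: "p \<in> ?I" for p
      proof -
        have "W L \<chi> * (\<phi> p * L \<phi>) \<le> \<chi> p" if \<chi>: "\<chi> \<in> Obs ?T" for \<chi>
        proof -
          have "W L \<chi> * (\<phi> p * L \<phi>) = \<phi> p * (L \<phi> * W L \<chi>)" by (simp add: ac_simps)
          also have "\<dots> \<le> \<phi> p * Hom ?T \<phi> \<chi>"
            unfolding W_def by (intro q_mult_mono_right INF_qimp_mult \<phi>)
          also have "\<dots> \<le> \<chi> p" unfolding qtensor_def using p by (simp add: INF_qimp_mult)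
          finally show ?thesis .
        qed
        then show ?thesis using p by (simp add: S_def le_INF_qimp_iff)
      qed
      then have "L \<phi> \<le> Hom ?T \<phi> (S L)" by (simp add: qtensor_def le_INF_qimp_iff)
      then have "L \<phi> * Hom ?T (S L) \<psi> \<le> Hom ?T (S L) \<psi> * Hom ?T \<phi> (S L)"
        by (metis mult.commute q_mult_mono_right)
      also have "\<dots> \<le> Hom ?T \<phi> \<psi>" by (rule qcat_trans[OF qcategory_qtensor \<phi> S \<psi>])
      finally show ?thesis .
    qed
    then show "Hom ?T (S L) \<psi> \<le> W L \<psi>" by (simp add: W_def le_INF_qimp_iff)
  qed
  moreover have "Hom (presheaves ?T) L (yoneda ?T \<psi>) = W L \<psi>" for L \<psi>
    by (simp add: presheaves_def yoneda_def W_def cong: INF_cong)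
  ultimately have "adjunction (presheaves ?T) ?T S (yoneda ?T)"
    using S yoneda_in[OF qcategory_qtensor[of A B]]
    by (intro adjunctionI qcategory_presheaves qcategory_qtensor) auto
  then show ?thesis
    using qcategory_qtensor skeletal_qtensor by (auto simp: qsup_object_def cocomplete_def)
qed

lemma pure_tensor_in:
  assumes "qsup_object A" "qsup_object B"
  shows "pure_tensor A B a b \<in> Obs (qtensor A B)"
  unfolding pure_tensor_def by (rule qtensor_limit[OF assms])

lemma Hom_pure_tensor:
  assumes A: "qsup_object A" and B: "qsup_object B"
    and a: "a \<in> Obs A" and b: "b \<in> Obs B" and \<phi>: "\<phi> \<in> Obs (qtensor A B)"
  shows "Hom (qtensor A B) (pure_tensor A B a b) \<phi> = \<phi> (a, b)"
proof (rule antisym)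
  have "pure_tensor A B a b p * \<phi> (a, b) \<le> \<phi> p" if "p \<in> Obs A \<times> Obs B" for p
    using that INF_qimp_mult[OF \<phi>, of "\<lambda>\<phi>. \<phi> (a, b)" "\<lambda>\<phi>. \<phi> p"]
    by (simp add: pure_tensor_def mult.commute)
  then show "\<phi> (a, b) \<le> Hom (qtensor A B) (pure_tensor A B a b) \<phi>"
    by (simp add: qtensor_def le_INF_qimp_iff)
  let ?h = "Hom (qtensor A B) (pure_tensor A B a b) \<phi>"
  have "1 \<le> pure_tensor A B a b (a, b)" using a b by (simp add: pure_tensor_def le_INF_qimp_iff)
  then have "1 * ?h \<le> pure_tensor A B a b (a, b) * ?h" by (rule q_mult_mono) simp
  also have "\<dots> \<le> \<phi> (a, b)" using a b by (simp add: qtensor_def INF_qimp_mult)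
  finally show "?h \<le> \<phi> (a, b)" by simp
qed

lemma bimorphism_pure_tensor:
  assumes A: "qsup_object A" and B: "qsup_object B"
  shows "bimorphism A B (qtensor A B) (pure_tensor A B)"
proof -
  let ?T = "qtensor A B"
  have T: "qsup_object ?T" by (rule qsup_object_qtensor[OF A B])
  have "\<exists>G. adjunction A ?T (\<lambda>a. pure_tensor A B a b) G" if b: "b \<in> Obs B" for b
  proof -
    have "\<forall>\<phi>\<in>Obs ?T. \<exists>a'\<in>Obs A. \<forall>a\<in>Obs A. \<phi> (a, b) = Hom A a a'"
      using b by (auto simp: qtensor_def)
    then obtain g where "\<And>\<phi>. \<phi> \<in> Obs ?T \<Longrightarrow> g \<phi> \<in> Obs A"
      "\<And>\<phi> a. \<phi> \<in> Obs ?T \<Longrightarrow> a \<in> Obs A \<Longrightarrow> \<phi> (a, b) = Hom A a (g \<phi>)" by metis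
    then have "adjunction A ?T (\<lambda>a. pure_tensor A B a b) g"
      using A b by (intro adjunctionI qcategory_qtensor)
        (auto simp: Hom_pure_tensor[OF A B] pure_tensor_in[OF A B] qsup_object_def)
    then show ?thesis by blast
  qed
  moreover have "\<exists>G. adjunction B ?T (pure_tensor A B a) G" if a: "a \<in> Obs A" for a
  proof -
    have "\<forall>\<phi>\<in>Obs ?T. \<exists>b'\<in>Obs B. \<forall>b\<in>Obs B. \<phi> (a, b) = Hom B b b'"
      using a by (auto simp: qtensor_def)
    then obtain g where "\<And>\<phi>. \<phi> \<in> Obs ?T \<Longrightarrow> g \<phi> \<in> Obs B"
      "\<And>\<phi> b. \<phi> \<in> Obs ?T \<Longrightarrow> b \<in> Obs B \<Longrightarrow> \<phi> (a, b) = Hom B b (g \<phi>)" by metis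
    then have "adjunction B ?T (pure_tensor A B a) g"
      using B a by (intro adjunctionI qcategory_qtensor)
        (auto simp: Hom_pure_tensor[OF A B] pure_tensor_in[OF A B] qsup_object_def)
    then show ?thesis by blast
  qed
  ultimately show ?thesis using A B T by (simp add: bimorphism_def qsup_mor_def)
qed

lemma qsup_object_nonempty: "qsup_object A \<Longrightarrow> Obs A \<noteq> {}"
  using qsup_weighted_limit[of A "{}"] by auto

lemma qtensor_factorization:
  assumes A: "qsup_object A" and B: "qsup_object B" and h: "bimorphism A B C h"
  shows "\<exists>!H. H \<in> extensional (Obs (qtensor A B)) \<and> qsup_mor (qtensor A B) C H \<and>
              (\<forall>a\<in>Obs A. \<forall>b\<in>Obs B. H (pure_tensor A B a b) = h a b)"
proof -
  let ?T = "qtensor A B" and ?I = "Obs A \<times> Obs B"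
  have T: "qsup_object ?T" by (rule qsup_object_qtensor[OF A B])
  have C: "qsup_object C"
    using h qsup_object_nonempty[OF A] by (auto simp: bimorphism_def qsup_mor_def)
  have Tq: "qcategory ?T" and Cq: "qcategory C" and Cs: "skeletal C"
    using T C by (auto simp: qsup_object_def)
  have h_in: "h a b \<in> Obs C" if a: "a \<in> Obs A" and b: "b \<in> Obs B" for a b
  proof -
    obtain R where "adjunction B C (h a) R"
      using h a by (auto simp: bimorphism_def qsup_mor_def)
    then show ?thesis using b by (auto simp: adjunction_def qfunctor_def)
  qed
  define G where "G c = (\<lambda>p\<in>?I. Hom C (h (fst p) (snd p)) c)" for c
  have G: "G c \<in> Obs ?T" if c: "c \<in> Obs C" for c
  proof -
    have "\<exists>a'\<in>Obs A. \<forall>a\<in>Obs A. Hom C (h a b) c = Hom A a a'" if b: "b \<in> Obs B" for b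
    proof -
      obtain R where R: "adjunction A C (\<lambda>a. h a b) R"
        using h b by (auto simp: bimorphism_def qsup_mor_def)
      then have "R c \<in> Obs A" "\<forall>a\<in>Obs A. Hom C (h a b) c = Hom A a (R c)"
        using c by (auto simp: adjunction_def qfunctor_def)
      then show ?thesis by blast
    qed
    moreover have "\<exists>b'\<in>Obs B. \<forall>b\<in>Obs B. Hom C (h a b) c = Hom B b b'" if a: "a \<in> Obs A" for a
    proof -
      obtain R where R: "adjunction B C (h a) R"
        using h a by (auto simp: bimorphism_def qsup_mor_def)
      then have "R c \<in> Obs B" "\<forall>b\<in>Obs B. Hom C (h a b) c = Hom B b (R c)"
        using c by (auto simp: adjunction_def qfunctor_def)
      then show ?thesis by blast
    qed
    ultimately show ?thesis by (simp add: qtensor_def G_def)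
  qed
  define w where "w l \<phi> c \<longleftrightarrow>
    Hom C l c = (INF p\<in>?I. \<phi> p \<rightharpoonup> Hom C (h (fst p) (snd p)) c)" for l \<phi> c
  have "\<forall>\<phi>. \<exists>l. l \<in> Obs C \<and> (\<forall>c\<in>Obs C. w l \<phi> c)"
  proof
    fix \<phi>
    show "\<exists>l. l \<in> Obs C \<and> (\<forall>c\<in>Obs C. w l \<phi> c)"
      using qsup_weighted_colimit[OF C, of ?I "\<lambda>p. h (fst p) (snd p)" \<phi>] h_in
      unfolding w_def by fastforce
  qed
  from choice[OF this] obtain K where K: "\<And>\<phi>. K \<phi> \<in> Obs C"
    "\<And>\<phi> c. c \<in> Obs C \<Longrightarrow> w (K \<phi>) \<phi> c" by auto
  have KG: "Hom C (K \<phi>) c = Hom ?T \<phi> (G c)" if "c \<in> Obs C" for \<phi> c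
    using K(2)[OF that] unfolding w_def by (simp add: qtensor_def G_def cong: INF_cong)
  define H where "H = restrict K (Obs ?T)"
  have "adjunction ?T C H G"
    by (rule adjunctionI[OF Tq Cq]) (auto simp: H_def K(1) G KG)
  then have mor: "qsup_mor ?T C H" using T C by (auto simp: qsup_mor_def)
  have H_pure: "H (pure_tensor A B a b) = h a b" if a: "a \<in> Obs A" and b: "b \<in> Obs B" for a b
  proof (rule skeletal_eqI[OF Cq Cs])
    have p: "pure_tensor A B a b \<in> Obs ?T" by (rule pure_tensor_in[OF A B])
    then show "H (pure_tensor A B a b) \<in> Obs C" by (simp add: H_def K(1))
    show "h a b \<in> Obs C" by (rule h_in[OF a b])
    fix c assume c: "c \<in> Obs C"
    then show "Hom C (H (pure_tensor A B a b)) c = Hom C (h a b) c"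
      using a b p by (simp add: H_def KG Hom_pure_tensor[OF A B a b G]) (simp add: G_def)
  qed
  show ?thesis
  proof (rule ex1I[of _ H])
    show "H \<in> extensional (Obs ?T) \<and> qsup_mor ?T C H \<and>
      (\<forall>a\<in>Obs A. \<forall>b\<in>Obs B. H (pure_tensor A B a b) = h a b)"
      using mor H_pure by (simp add: H_def)
    fix H' assume H': "H' \<in> extensional (Obs ?T) \<and> qsup_mor ?T C H' \<and>
      (\<forall>a\<in>Obs A. \<forall>b\<in>Obs B. H' (pure_tensor A B a b) = h a b)"
    then obtain G' where adj: "adjunction ?T C H' G'" by (auto simp: qsup_mor_def)
    have G': "G' c \<in> Obs ?T" if "c \<in> Obs C" for c
      using adj that by (auto simp: adjunction_def qfunctor_def)
    have GG': "G' c = G c" if c: "c \<in> Obs C" for c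
    proof (rule extensionalityI[of _ ?I])
      show "G' c \<in> extensional ?I" "G c \<in> extensional ?I"
        using G'[OF c] by (auto simp: qtensor_def G_def)
      fix p assume p: "p \<in> ?I"
      then obtain a b where ab: "p = (a, b)" "a \<in> Obs A" "b \<in> Obs B" by auto
      have "G' c (a, b) = Hom ?T (pure_tensor A B a b) (G' c)"
        using Hom_pure_tensor[OF A B ab(2,3) G'[OF c]] by simp
      also have "\<dots> = Hom C (H' (pure_tensor A B a b)) c"
        using adj c pure_tensor_in[OF A B] by (simp add: adjunction_def)
      also have "\<dots> = Hom C (h a b) c" using H' ab by simp
      finally show "G' c p = G c p" using ab by (simp add: G_def)
    qed
    show "H' = H"
    proof (rule extensionalityI[of _ "Obs ?T"])
      show "H' \<in> extensional (Obs ?T)" "H \<in> extensional (Obs ?T)" using H' by (auto simp: H_def)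
      fix \<phi> assume \<phi>: "\<phi> \<in> Obs ?T"
      show "H' \<phi> = H \<phi>"
      proof (rule skeletal_eqI[OF Cq Cs])
        show "H' \<phi> \<in> Obs C" using adj \<phi> by (auto simp: adjunction_def qfunctor_def)
        show "H \<phi> \<in> Obs C" using \<phi> by (simp add: H_def K(1))
        fix c assume c: "c \<in> Obs C"
        have "Hom C (H' \<phi>) c = Hom ?T \<phi> (G' c)" using adj \<phi> c by (simp add: adjunction_def)
        then show "Hom C (H' \<phi>) c = Hom C (H \<phi>) c" using \<phi> c by (simp add: H_def KG GG')
      qed
    qed
  qed
qed

theorem qtensor_represents:
  fixes A :: "('a, 'q::comm_unital_quantale) qcat" and B :: "('b, 'q) qcat"
  assumes "qsup_object A" and "qsup_object B"
  shows "represents_bimorphisms TYPE('c) A B (qtensor A B) (pure_tensor A B)"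
  unfolding represents_bimorphisms_def
  using bimorphism_pure_tensor[OF assms] qtensor_factorization[OF assms] by blast

lemma qsup_mor_in: "qsup_mor A B F \<Longrightarrow> a \<in> Obs A \<Longrightarrow> F a \<in> Obs B"
  by (auto simp: qsup_mor_def adjunction_def qfunctor_def)

lemma qsup_mor_comp:
  assumes "qsup_mor A B F" and "qsup_mor B C G"
  shows "qsup_mor A C (\<lambda>a. G (F a))"
proof -
  obtain F' where F': "adjunction A B F F'" using assms(1) by (auto simp: qsup_mor_def)
  obtain G' where G': "adjunction B C G G'" using assms(2) by (auto simp: qsup_mor_def)
  have F'_in: "F' b \<in> Obs A" if "b \<in> Obs B" for b
    using F' that by (auto simp: adjunction_def qfunctor_def)
  have G'_in: "G' c \<in> Obs B" if "c \<in> Obs C" for c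
    using G' that by (auto simp: adjunction_def qfunctor_def)
  have AC: "qsup_object A" "qsup_object C" using assms by (auto simp: qsup_mor_def)
  have "adjunction A C (\<lambda>a. G (F a)) (\<lambda>c. F' (G' c))"
  proof (rule adjunctionI)
    show "qcategory A" "qcategory C" using AC by (auto simp: qsup_object_def)
    show "(\<lambda>a. G (F a)) \<in> Obs A \<rightarrow> Obs C"
      using qsup_mor_in[OF assms(1)] qsup_mor_in[OF assms(2)] by auto
    show "(\<lambda>c. F' (G' c)) \<in> Obs C \<rightarrow> Obs A" using F'_in G'_in by auto
    fix a c assume a: "a \<in> Obs A" and c: "c \<in> Obs C"
    have "Hom C (G (F a)) c = Hom B (F a) (G' c)"
      using G' qsup_mor_in[OF assms(1) a] c by (simp add: adjunction_def)
    also have "\<dots> = Hom A a (F' (G' c))" using F' a G'_in[OF c] by (simp add: adjunction_def)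
    finally show "Hom C (G (F a)) c = Hom A a (F' (G' c))" .
  qed
  then show ?thesis using AC by (auto simp: qsup_mor_def)
qed

theorem qtensor_map:
  assumes F: "qsup_mor A A' F" and G: "qsup_mor B B' G"
  defines "H \<equiv> qtensor_map A B A' B' F G"
  shows "H \<in> extensional (Obs (qtensor A B))"
    and "qsup_mor (qtensor A B) (qtensor A' B') H"
    and "\<And>a b. a \<in> Obs A \<Longrightarrow> b \<in> Obs B \<Longrightarrow> H (pure_tensor A B a b) = pure_tensor A' B' (F a) (G b)"
proof -
  have ob: "qsup_object A" "qsup_object B" "qsup_object A'" "qsup_object B'"
    using F G by (auto simp: qsup_mor_def)
  have p: "bimorphism A' B' (qtensor A' B') (pure_tensor A' B')"
    by (rule bimorphism_pure_tensor[OF ob(3,4)])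
  have "bimorphism A B (qtensor A' B') (\<lambda>a b. pure_tensor A' B' (F a) (G b))"
    unfolding bimorphism_def
  proof (intro conjI ballI)
    fix b assume "b \<in> Obs B"
    then have "qsup_mor A' (qtensor A' B') (\<lambda>a. pure_tensor A' B' a (G b))"
      using p qsup_mor_in[OF G] by (simp add: bimorphism_def)
    then show "qsup_mor A (qtensor A' B') (\<lambda>a. pure_tensor A' B' (F a) (G b))"
      by (rule qsup_mor_comp[OF F])
  next
    fix a assume "a \<in> Obs A"
    then have "qsup_mor B' (qtensor A' B') (pure_tensor A' B' (F a))"
      using p qsup_mor_in[OF F] by (simp add: bimorphism_def)
    then show "qsup_mor B (qtensor A' B') (\<lambda>b. pure_tensor A' B' (F a) (G b))"
      by (rule qsup_mor_comp[OF G])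
  qed
  from theI'[OF qtensor_factorization[OF ob(1,2) this]]
  show "H \<in> extensional (Obs (qtensor A B))"
    and "qsup_mor (qtensor A B) (qtensor A' B') H"
    and "\<And>a b. a \<in> Obs A \<Longrightarrow> b \<in> Obs B \<Longrightarrow> H (pure_tensor A B a b) = pure_tensor A' B' (F a) (G b)"
    unfolding H_def qtensor_map_def by auto
qed

end

theory Submission
  imports Defs
begin

text \<open>
  A regular relation \<open>\<alpha> = \<alpha> \<circ> \<gamma> \<circ> \<alpha>\<close> makes \<open>E z = (\<gamma> \<circ> \<alpha>)(-, z)\<close>
  a dual basis of \<open>D \<alpha>\<close>: every \<open>\<mu>\<close> is the join of the \<open>\<mu> z * E z\<close>.  The bimorphism
  \<open>(\<mu>, \<nu>) \<mapsto> \<mu> * \<nu>\<close> induces \<open>\<theta> \<phi> = SUP \<mu> \<nu>. \<phi> (\<mu>, \<nu>) * (\<mu> * \<nu>)\<close>, whose right adjoint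
  \<open>M \<mapsto> Hom (\<mu> * \<nu>) M\<close> is inverse to it because \<open>E z * E' z'\<close> is again a dual basis.
  Naturality only has to be checked on pure tensors.  For the last claim, the totally below
  distributors of \<open>A\<close> and \<open>B\<close> multiply to one for \<open>A \<otimes> B\<close>, and every presheaf on
  \<open>A \<otimes> B\<close> has the colimit
  \<open>(a, b) \<mapsto> INF x y. T a x * T b y \<rightharpoonup> \<Lambda> (x \<otimes> y)\<close>.
\<close>

section \<open>Quantales\<close>

lemma mult_SUP: "a * (SUP i\<in>I. f i) = (SUP i\<in>I. a * (f i :: 'q::comm_unital_quantale))"
  by (simp add: mult_Sup_distrib image_image)

lemma SUP_mult: "(SUP i\<in>I. f i) * a = (SUP i\<in>I. f i * (a :: 'q::comm_unital_quantale))"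
  by (metis (no_types, lifting) SUP_cong mult.commute mult_SUP)

lemma SUP_times: "(SUP p\<in>A \<times> B. f p) = (SUP a\<in>A. SUP b\<in>B. f (a, b) :: 'q::complete_lattice)"
  by (rule antisym) (auto intro!: SUP_least intro: SUP_upper2)

text \<open>Equalities between infima of residua are proved through their lower bounds, because
  \<open>le_INF_qimp_iff\<close> turns each such lower bound into plain inequalities.\<close>

lemma eq_of_le_iff: "(\<And>q. q \<le> a \<longleftrightarrow> q \<le> b) \<Longrightarrow> a = (b :: 'q::order)"
  by (meson order.antisym order.refl)

lemma SUP_mult_le_iff:
  "(SUP i\<in>I. f i) * a \<le> c \<longleftrightarrow> (\<forall>i\<in>I. f i * a \<le> (c :: 'q::comm_unital_quantale))"
  by (simp add: SUP_mult SUP_le_iff)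

lemma INF_qimp_trans:
  "(INF i\<in>I. y i \<rightharpoonup> z i) * (INF i\<in>I. x i \<rightharpoonup> y i) \<le> (INF i\<in>I. x i \<rightharpoonup> (z i :: 'q::comm_unital_quantale))"
proof -
  have "x i * ((INF i\<in>I. y i \<rightharpoonup> z i) * (INF i\<in>I. x i \<rightharpoonup> y i)) \<le> z i" if i: "i \<in> I" for i
  proof -
    have "x i * ((INF i\<in>I. y i \<rightharpoonup> z i) * (INF i\<in>I. x i \<rightharpoonup> y i))
        = (x i * (INF i\<in>I. x i \<rightharpoonup> y i)) * (INF i\<in>I. y i \<rightharpoonup> z i)"
      by (simp add: ac_simps)
    also have "\<dots> \<le> y i * (INF i\<in>I. y i \<rightharpoonup> z i)"
      by (intro q_mult_mono INF_qimp_mult i order_refl)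
    also have "\<dots> \<le> z i" by (rule INF_qimp_mult[OF i])
    finally show ?thesis .
  qed
  then show ?thesis by (simp add: le_INF_qimp_iff)
qed


section \<open>The concept lattices\<close>

text \<open>A factor \<open>v\<close> of \<open>f\<close> over \<alpha> always lies below the
  residual \<open>lresid f \<alpha>\<close>, whose composite with \<alpha> never exceeds
  \<open>f\<close>; dually for \<open>u\<close>. Hence any factorization, by arbitrary functions,
  can replace the residuals.\<close>

lemma dmor_iff:
  "dmor f \<alpha> \<beta> \<longleftrightarrow> src f = src \<alpha> \<and> tgt f = tgt \<beta> \<and>
    (\<exists>v. \<forall>x\<in>src \<alpha>. \<forall>z\<in>tgt \<beta>. val f x z = (SUP y\<in>tgt \<alpha>. v y z * val \<alpha> x y)) \<and>
    (\<exists>u. \<forall>x\<in>src \<alpha>. \<forall>z\<in>tgt \<beta>. val f x z = (SUP y\<in>src \<beta>. val \<beta> y z * u x y))"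
proof
  assume f: "dmor f \<alpha> \<beta>"
  then have st: "src f = src \<alpha>" "tgt f = tgt \<beta>" by (auto simp: dmor_def)
  have "val f x z = (SUP y\<in>tgt \<alpha>. val (lresid f \<alpha>) y z * val \<alpha> x y)"
    if "x \<in> src \<alpha>" "z \<in> tgt \<beta>" for x z
  proof -
    have "val f x z = val (qcomp (lresid f \<alpha>) \<alpha>) x z" using f by (simp add: dmor_def)
    then show ?thesis using that st by (simp add: qcomp_def lresid_def)
  qed
  moreover have "val f x z = (SUP y\<in>src \<beta>. val \<beta> y z * val (rresid \<beta> f) x y)"
    if "x \<in> src \<alpha>" "z \<in> tgt \<beta>" for x z
  proof -
    have "val f x z = val (qcomp \<beta> (rresid \<beta> f)) x z" using f by (simp add: dmor_def)
    then show ?thesis using that st by (simp add: qcomp_def rresid_def)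
  qed
  ultimately show "src f = src \<alpha> \<and> tgt f = tgt \<beta> \<and>
    (\<exists>v. \<forall>x\<in>src \<alpha>. \<forall>z\<in>tgt \<beta>. val f x z = (SUP y\<in>tgt \<alpha>. v y z * val \<alpha> x y)) \<and>
    (\<exists>u. \<forall>x\<in>src \<alpha>. \<forall>z\<in>tgt \<beta>. val f x z = (SUP y\<in>src \<beta>. val \<beta> y z * u x y))"
    using st by blast
next
  assume "src f = src \<alpha> \<and> tgt f = tgt \<beta> \<and>
    (\<exists>v. \<forall>x\<in>src \<alpha>. \<forall>z\<in>tgt \<beta>. val f x z = (SUP y\<in>tgt \<alpha>. v y z * val \<alpha> x y)) \<and>
    (\<exists>u. \<forall>x\<in>src \<alpha>. \<forall>z\<in>tgt \<beta>. val f x z = (SUP y\<in>src \<beta>. val \<beta> y z * u x y))"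
  then obtain u v where st: "src f = src \<alpha>" "tgt f = tgt \<beta>"
    and v: "\<And>x z. x \<in> src \<alpha> \<Longrightarrow> z \<in> tgt \<beta> \<Longrightarrow> val f x z = (SUP y\<in>tgt \<alpha>. v y z * val \<alpha> x y)"
    and u: "\<And>x z. x \<in> src \<alpha> \<Longrightarrow> z \<in> tgt \<beta> \<Longrightarrow> val f x z = (SUP y\<in>src \<beta>. val \<beta> y z * u x y)"
    by blast
  have "qcomp (lresid f \<alpha>) \<alpha> = f"
  proof (rule qrel_eqI)
    fix x z assume "x \<in> src (qcomp (lresid f \<alpha>) \<alpha>)" "z \<in> tgt (qcomp (lresid f \<alpha>) \<alpha>)"
    then have x: "x \<in> src \<alpha>" and z: "z \<in> tgt \<beta>" by (auto simp: qcomp_def lresid_def st)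
    have "v y z \<le> (INF x\<in>src \<alpha>. val \<alpha> x y \<rightharpoonup> val f x z)" if "y \<in> tgt \<alpha>" for y
      unfolding le_INF_qimp_iff using v z that by (auto simp: mult.commute intro!: SUP_upper)
    then have "val f x z \<le> (SUP y\<in>tgt \<alpha>. (INF x\<in>src \<alpha>. val \<alpha> x y \<rightharpoonup> val f x z) * val \<alpha> x y)"
      unfolding v[OF x z] by (intro SUP_mono) (auto intro: q_mult_mono)
    moreover have "(SUP y\<in>tgt \<alpha>. (INF x\<in>src \<alpha>. val \<alpha> x y \<rightharpoonup> val f x z) * val \<alpha> x y) \<le> val f x z"
      using INF_qimp_mult[OF x] by (auto simp: SUP_le_iff mult.commute[of _ "val \<alpha> x _"])
    ultimately show "val (qcomp (lresid f \<alpha>) \<alpha>) x z = val f x z"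
      using x z st by (simp add: qcomp_def lresid_def)
  qed (simp_all add: qcomp_def lresid_def st)
  moreover have "qcomp \<beta> (rresid \<beta> f) = f"
  proof (rule qrel_eqI)
    fix x z assume "x \<in> src (qcomp \<beta> (rresid \<beta> f))" "z \<in> tgt (qcomp \<beta> (rresid \<beta> f))"
    then have x: "x \<in> src \<alpha>" and z: "z \<in> tgt \<beta>" by (auto simp: qcomp_def rresid_def st)
    have "u x y \<le> (INF z\<in>tgt \<beta>. val \<beta> y z \<rightharpoonup> val f x z)" if "y \<in> src \<beta>" for y
      unfolding le_INF_qimp_iff using u x that by (auto intro!: SUP_upper)
    then have "val f x z \<le> (SUP y\<in>src \<beta>. val \<beta> y z * (INF z\<in>tgt \<beta>. val \<beta> y z \<rightharpoonup> val f x z))"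
      unfolding u[OF x z] by (intro SUP_mono) (auto intro: q_mult_mono)
    moreover have "(SUP y\<in>src \<beta>. val \<beta> y z * (INF z\<in>tgt \<beta>. val \<beta> y z \<rightharpoonup> val f x z)) \<le> val f x z"
      using z by (simp add: SUP_le_iff INF_qimp_mult)
    ultimately show "val (qcomp \<beta> (rresid \<beta> f)) x z = val f x z"
      using x z st by (simp add: qcomp_def rresid_def)
  qed (simp_all add: qcomp_def rresid_def st)
  ultimately show "dmor f \<alpha> \<beta>" using st by (simp add: dmor_def)
qed

text \<open>The factorization through \<open>star_k\<close> is automatic, since the only value of
  \<open>star_k\<close> is the unit. What remains is that \<open>m\<close> is a weighted join of the
  columns of \<alpha>, which makes closure properties easy to check.\<close>

lemma Obs_Dobj_iff:
  "m \<in> Obs (Dobj \<alpha>) \<longleftrightarrow> src m = src \<alpha> \<and> tgt m = {()} \<and>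
    (\<exists>v. \<forall>x\<in>src \<alpha>. val m x () = (SUP y\<in>tgt \<alpha>. v y * val \<alpha> x y))"
proof -
  have "(\<exists>v. \<forall>x\<in>src \<alpha>. val m x () = (SUP y\<in>tgt \<alpha>. v y () * val \<alpha> x y)) \<longleftrightarrow>
    (\<exists>v. \<forall>x\<in>src \<alpha>. val m x () = (SUP y\<in>tgt \<alpha>. v y * val \<alpha> x y))"
    by (rule iffI; elim exE) (rule exI, assumption, rule_tac x = "\<lambda>y _. v y" in exI, simp)
  moreover have "\<exists>u :: _ \<Rightarrow> unit \<Rightarrow> _. \<forall>x\<in>src \<alpha>. val m x () = u x ()"
    by (rule exI[of _ "val m"]) simp
  ultimately show ?thesis by (simp add: Dobj_def dhom_def dmor_iff star_k_def)
qed

lemma Dobj_src_tgt: "m \<in> Obs (Dobj \<alpha>) \<Longrightarrow> src m = src \<alpha>" "m \<in> Obs (Dobj \<alpha>) \<Longrightarrow> tgt m = {()}"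
  by (simp_all add: Obs_Dobj_iff)

lemma Dobj_eqI:
  assumes "m \<in> Obs (Dobj \<alpha>)" "n \<in> Obs (Dobj \<alpha>)"
    and "\<And>x. x \<in> src \<alpha> \<Longrightarrow> val m x () = val n x ()"
  shows "m = n"
  using assms by (intro qrel_eqI) (auto simp: Dobj_src_tgt)

text \<open>The action is residuated: \<open>q\<close> acting on \<open>m\<close> stays below
  \<open>n\<close> exactly when \<open>q\<close> is below the infimum. So D \<alpha> carries the hom
  of a presheaf category over the discrete set \<open>src \<alpha>\<close>.\<close>

lemma Hom_Dobj:
  assumes "m \<in> Obs (Dobj \<alpha>)" "n \<in> Obs (Dobj \<alpha>)"
  shows "Hom (Dobj \<alpha>) m n = (INF x\<in>src \<alpha>. val m x () \<rightharpoonup> val n x ())"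
proof -
  have "qrel_le (qaction q m) n \<longleftrightarrow> q \<le> (INF x\<in>src \<alpha>. val m x () \<rightharpoonup> val n x ())" for q
    using Dobj_src_tgt[OF assms(1)] Dobj_src_tgt[OF assms(2)]
    by (simp add: qrel_le_def qaction_def le_INF_qimp_iff mult.commute)
  then show ?thesis
    by (simp add: Dobj_def dhom_def) (intro antisym Sup_least Sup_upper, auto)
qed

lemma le_Hom_Dobj_iff:
  assumes "m \<in> Obs (Dobj \<alpha>)" "n \<in> Obs (Dobj \<alpha>)"
  shows "q \<le> Hom (Dobj \<alpha>) m n \<longleftrightarrow> (\<forall>x\<in>src \<alpha>. val m x () * q \<le> val n x ())"
  by (simp add: Hom_Dobj[OF assms] le_INF_qimp_iff)

section \<open>Weighted joins of concepts\<close>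

definition Dsup :: "'x set \<Rightarrow> 'i set \<Rightarrow> ('i \<Rightarrow> 'q) \<Rightarrow> ('i \<Rightarrow> ('x, unit, 'q) qrel) \<Rightarrow>
    ('x, unit, 'q::comm_unital_quantale) qrel"
  where "Dsup X I w c = Qrel X {()} (\<lambda>x _. SUP i\<in>I. w i * val (c i) x ())"

lemma val_Dsup [simp]: "x \<in> X \<Longrightarrow> val (Dsup X I w c) x () = (SUP i\<in>I. w i * val (c i) x ())"
  by (simp add: Dsup_def)

text \<open>Coefficients over \<alpha> combine linearly: if \<open>v i\<close> expresses
  \<open>c i\<close>, then the join of \<open>w i * v i y\<close> over \<open>i\<close> expresses
  the weighted join.\<close>

lemma Dsup_in:
  assumes "\<And>i. i \<in> I \<Longrightarrow> c i \<in> Obs (Dobj \<alpha>)"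
  shows "Dsup (src \<alpha>) I w c \<in> Obs (Dobj \<alpha>)"
proof -
  have "\<forall>i\<in>I. \<exists>v. \<forall>x\<in>src \<alpha>. val (c i) x () = (SUP y\<in>tgt \<alpha>. v y * val \<alpha> x y)"
    using assms by (auto simp: Obs_Dobj_iff)
  then obtain v where v: "\<And>i x. i \<in> I \<Longrightarrow> x \<in> src \<alpha> \<Longrightarrow>
      val (c i) x () = (SUP y\<in>tgt \<alpha>. v i y * val \<alpha> x y)"
    by metis
  have "(SUP i\<in>I. w i * val (c i) x ()) = (SUP y\<in>tgt \<alpha>. (SUP i\<in>I. w i * v i y) * val \<alpha> x y)"
    if "x \<in> src \<alpha>" for x
    using v that by (simp add: mult_SUP SUP_mult mult.assoc SUP_commute[of _ I] cong: SUP_cong)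
  then have "\<exists>v. \<forall>x\<in>src \<alpha>. (SUP i\<in>I. w i * val (c i) x ()) = (SUP y\<in>tgt \<alpha>. v y * val \<alpha> x y)"
    by (intro exI ballI)
  then show ?thesis by (simp add: Obs_Dobj_iff Dsup_def)
qed

lemma qcategory_Dobj: "qcategory (Dobj \<alpha>)"
  unfolding qcategory_def by (simp add: Hom_Dobj INF_qimp_trans) (simp add: le_INF_qimp_iff)

text \<open>This is the universal property of a weighted colimit, so \<open>Dsup\<close> serves
  below for the colimit of a presheaf and for the comparison map.\<close>

lemma Hom_Dsup:
  assumes c: "\<And>i. i \<in> I \<Longrightarrow> c i \<in> Obs (Dobj \<alpha>)" and m: "m \<in> Obs (Dobj \<alpha>)"
  shows "Hom (Dobj \<alpha>) (Dsup (src \<alpha>) I w c) m = (INF i\<in>I. w i \<rightharpoonup> Hom (Dobj \<alpha>) (c i) m)"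
proof (rule eq_of_le_iff)
  fix q
  have "q \<le> Hom (Dobj \<alpha>) (Dsup (src \<alpha>) I w c) m \<longleftrightarrow>
      (\<forall>x\<in>src \<alpha>. \<forall>i\<in>I. w i * val (c i) x () * q \<le> val m x ())"
    by (simp add: le_Hom_Dobj_iff[OF Dsup_in[OF c] m] SUP_mult_le_iff)
  also have "\<dots> \<longleftrightarrow> (\<forall>i\<in>I. w i * q \<le> Hom (Dobj \<alpha>) (c i) m)"
    using c m by (auto simp: le_Hom_Dobj_iff ac_simps)
  finally show "q \<le> Hom (Dobj \<alpha>) (Dsup (src \<alpha>) I w c) m \<longleftrightarrow>
      q \<le> (INF i\<in>I. w i \<rightharpoonup> Hom (Dobj \<alpha>) (c i) m)"
    by (simp add: le_INF_qimp_iff)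
qed

lemma qsup_object_Dobj: "qsup_object (Dobj \<alpha>)"
proof -
  let ?D = "Dobj \<alpha>"
  have "skeletal ?D"
    unfolding skeletal_def by (auto simp: le_Hom_Dobj_iff intro!: Dobj_eqI[of _ \<alpha>] antisym)
  \<comment> \<open>The colimit of a presheaf \<open>L\<close> is the join of all concepts, each
    weighted by its own value under \<open>L\<close>.\<close>
  moreover have "adjunction (presheaves ?D) ?D (\<lambda>L. Dsup (src \<alpha>) (Obs ?D) L id) (yoneda ?D)"
  proof (rule adjunctionI[OF qcategory_presheaves qcategory_Dobj])
    fix L m assume m: "m \<in> Obs ?D"
    show "Hom ?D (Dsup (src \<alpha>) (Obs ?D) L id) m = Hom (presheaves ?D) L (yoneda ?D m)"
      using m by (subst Hom_Dsup) (auto simp: presheaves_def yoneda_def cong: INF_cong)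
  qed (auto intro!: Dsup_in yoneda_in qcategory_Dobj)
  ultimately show ?thesis using qcategory_Dobj by (auto simp: qsup_object_def cocomplete_def)
qed

section \<open>Morphisms between concept lattices\<close>

text \<open>A map given by a matrix \<open>k\<close> respects weighted joins and therefore has a
  right adjoint. The criterion covers both precomposition \<open>Dmap\<close> and the two partial
  maps of \<open>Dtens\<close>.\<close>

lemma qsup_mor_Dobj:
  assumes F: "\<And>l. l \<in> Obs (Dobj \<alpha>) \<Longrightarrow> F l \<in> Obs (Dobj \<beta>)"
    and k: "\<And>l x. l \<in> Obs (Dobj \<alpha>) \<Longrightarrow> x \<in> src \<beta> \<Longrightarrow>
      val (F l) x () = (SUP y\<in>src \<alpha>. val l y () * k x y)"
  shows "qsup_mor (Dobj \<alpha>) (Dobj \<beta>) F"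
proof -
  let ?A = "Dobj \<alpha>" and ?B = "Dobj \<beta>"
  \<comment> \<open>The usual right adjoint formula: the join of all \<open>l\<close>, each weighted
    by the degree to which \<open>F l\<close> lies below \<open>m\<close>.\<close>
  define G where "G m = Dsup (src \<alpha>) (Obs ?A) (\<lambda>l. Hom ?B (F l) m) id" for m
  have G: "G m \<in> Obs ?A" for m unfolding G_def by (rule Dsup_in) simp
  have "adjunction ?A ?B F G"
  proof (rule adjunctionI[OF qcategory_Dobj qcategory_Dobj])
    fix l m assume l: "l \<in> Obs ?A" and m: "m \<in> Obs ?B"
    show "Hom ?B (F l) m = Hom ?A l (G m)"
    proof (rule antisym)
      show "Hom ?B (F l) m \<le> Hom ?A l (G m)"
        unfolding le_Hom_Dobj_iff[OF l G] using l by (auto simp: G_def mult.commute intro!: SUP_upper)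
      \<comment> \<open>Linearity of \<open>F\<close> enters here: applying the matrix to the join
        \<open>G m\<close> gives terms bounded by \<open>Hom ?B (F l') m * val (F l') x ()\<close>,
        each below \<open>m\<close>.\<close>
      have "val l y () * k x y * Hom ?A l (G m) \<le> val m x ()"
        if x: "x \<in> src \<beta>" and y: "y \<in> src \<alpha>" for x y
      proof -
        have "val l y () * Hom ?A l (G m) \<le> val (G m) y ()"
          using le_Hom_Dobj_iff[OF l G, THEN iffD1, OF order_refl] y by blast
        then have "val l y () * k x y * Hom ?A l (G m) \<le> val (G m) y () * k x y"
          by (metis mult.commute mult.left_commute q_mult_mono_right)
        also have "\<dots> \<le> val m x ()"
          unfolding G_def val_Dsup[OF y] SUP_mult_le_iff
        proof
          fix l' assume l': "l' \<in> Obs ?A"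
          have "val l' y () * k x y \<le> val (F l') x ()"
            unfolding k[OF l' x] using y by (rule SUP_upper)
          then have "Hom ?B (F l') m * val (id l') y () * k x y \<le> Hom ?B (F l') m * val (F l') x ()"
            by (simp add: mult.assoc q_mult_mono_right)
          also have "\<dots> \<le> val m x ()"
            using le_Hom_Dobj_iff[OF F[OF l'] m, THEN iffD1, OF order_refl] x
            by (simp add: mult.commute)
          finally show "Hom ?B (F l') m * val (id l') y () * k x y \<le> val m x ()" .
        qed
        finally show ?thesis .
      qed
      then show "Hom ?A l (G m) \<le> Hom ?B (F l) m"
        by (simp add: le_Hom_Dobj_iff[OF F[OF l] m] k[OF l] SUP_mult_le_iff)
    qed
  qed (auto intro: F G)
  then show ?thesis using qsup_object_Dobj[of \<alpha>] qsup_object_Dobj[of \<beta>] by (auto simp: qsup_mor_def)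
qed

text \<open>If \<open>l\<close> is \<open>v\<close> after \<alpha>, then composing with
  \<open>rresid \<alpha> f\<close> gives \<open>v\<close> after \<open>f\<close>, because \<alpha>
  after that residual is \<open>f\<close> again. Values of \<open>Dmap\<close> can thus be read off
  from any coefficients of \<open>l\<close>.\<close>

lemma val_Dmap:
  assumes f: "dmor f \<alpha>' \<alpha>" and l: "l \<in> Obs (Dobj \<alpha>)"
    and v: "\<And>y. y \<in> src \<alpha> \<Longrightarrow> val l y () = (SUP z\<in>tgt \<alpha>. v z * val \<alpha> y z)"
    and x: "x \<in> src \<alpha>'"
  shows "val (Dmap \<alpha> f l) x () = (SUP z\<in>tgt \<alpha>. v z * val f x z)"
proof -
  let ?r = "val (rresid \<alpha> f)"
  have st: "src f = src \<alpha>'" "tgt f = tgt \<alpha>" and f': "qcomp \<alpha> (rresid \<alpha> f) = f"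
    using f by (auto simp: dmor_def)
  have fr: "val f x z = (SUP y\<in>src \<alpha>. val \<alpha> y z * ?r x y)" if "z \<in> tgt \<alpha>" for z
    using arg_cong[OF f', of "\<lambda>f. val f x z"] that x st by (simp add: qcomp_def rresid_def)
  have "val (Dmap \<alpha> f l) x () = (SUP y\<in>src \<alpha>. val l y () * ?r x y)"
    using x st Dobj_src_tgt[OF l] by (simp add: Dmap_def dcomp_def qcomp_def rresid_def)
  also have "\<dots> = (SUP z\<in>tgt \<alpha>. v z * val f x z)"
    by (simp add: fr v mult_SUP SUP_mult mult.assoc SUP_commute[of _ "src \<alpha>"] cong: SUP_cong)
  finally show ?thesis .
qed

lemma qsup_mor_Dmap:
  assumes f: "dmor f \<alpha>' \<alpha>"
  shows "qsup_mor (Dobj \<alpha>) (Dobj \<alpha>') (Dmap \<alpha> f)"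
proof (rule qsup_mor_Dobj)
  have st: "src f = src \<alpha>'" "tgt f = tgt \<alpha>" using f by (auto simp: dmor_def)
  fix l assume l: "l \<in> Obs (Dobj \<alpha>)"
  obtain v where v: "\<And>y. y \<in> src \<alpha> \<Longrightarrow> val l y () = (SUP z\<in>tgt \<alpha>. v z * val \<alpha> y z)"
    using l by (auto simp: Obs_Dobj_iff)
  \<comment> \<open>Factoring \<open>f\<close> over \<alpha>' turns the coefficients
    \<open>v\<close> of \<open>l\<close> into coefficients of
    \<open>Dmap \<alpha> f l\<close>.\<close>
  obtain u where u: "\<And>x z. x \<in> src \<alpha>' \<Longrightarrow> z \<in> tgt \<alpha> \<Longrightarrow>
      val f x z = (SUP y\<in>tgt \<alpha>'. u y z * val \<alpha>' x y)"
    using f by (auto simp: dmor_iff)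
  have "val (Dmap \<alpha> f l) x () = (SUP y\<in>tgt \<alpha>'. (SUP z\<in>tgt \<alpha>. v z * u y z) * val \<alpha>' x y)"
    if x: "x \<in> src \<alpha>'" for x
    using val_Dmap[OF f l v x]
    by (simp add: u x mult_SUP SUP_mult mult.assoc SUP_commute[of _ "tgt \<alpha>'"] cong: SUP_cong)
  then have "\<exists>v. \<forall>x\<in>src \<alpha>'. val (Dmap \<alpha> f l) x () = (SUP y\<in>tgt \<alpha>'. v y * val \<alpha>' x y)"
    by (intro exI ballI)
  then show "Dmap \<alpha> f l \<in> Obs (Dobj \<alpha>')"
    using st Dobj_src_tgt[OF l] by (simp add: Obs_Dobj_iff)
      (simp add: Dmap_def dcomp_def qcomp_def rresid_def)
  show "val (Dmap \<alpha> f l) x () = (SUP y\<in>src \<alpha>. val l y () * val (rresid \<alpha> f) x y)"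
    if "x \<in> src \<alpha>'" for x
    using that st Dobj_src_tgt[OF l] by (simp add: Dmap_def dcomp_def qcomp_def rresid_def)
qed


section \<open>Tensor products of concepts\<close>

text \<open>The codomain of \<open>m \<circledast> n\<close>, a product of two singletons, is
  collapsed to one point so that the result can lie in a concept lattice.\<close>

definition Dtens :: "('x, unit, 'q) qrel \<Rightarrow> ('u, unit, 'q) qrel \<Rightarrow>
    ('x \<times> 'u, unit, 'q::comm_unital_quantale) qrel"
  where "Dtens m n = Qrel (src m \<times> src n) {()} (\<lambda>p _. val m (fst p) () * val n (snd p) ())"

lemma SUP_mult_SUP:
  "(SUP a\<in>A. f a) * (SUP b\<in>B. g b) = (SUP p\<in>A \<times> B. f (fst p) * (g (snd p) :: 'q::comm_unital_quantale))"
  by (simp add: SUP_times mult_SUP SUP_mult SUP_commute[of _ A B])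

lemma val_Dtens:
  assumes "m \<in> Obs (Dobj \<alpha>)" "n \<in> Obs (Dobj \<beta>)" "p \<in> src \<alpha> \<times> src \<beta>"
  shows "val (Dtens m n) p () = val m (fst p) () * val n (snd p) ()"
  using assms by (auto simp: Dtens_def Dobj_src_tgt)

lemma src_qprod [simp]: "src (\<alpha> \<circledast> \<beta>) = src \<alpha> \<times> src \<beta>"
  and tgt_qprod [simp]: "tgt (\<alpha> \<circledast> \<beta>) = tgt \<alpha> \<times> tgt \<beta>"
  by (simp_all add: qprod_def)

lemma val_qprod:
  "p \<in> src \<alpha> \<times> src \<beta> \<Longrightarrow> s \<in> tgt \<alpha> \<times> tgt \<beta> \<Longrightarrow>
    val (\<alpha> \<circledast> \<beta>) p s = val \<alpha> (fst p) (fst s) * val \<beta> (snd p) (snd s)"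
  by (simp add: qprod_def)

text \<open>Products distribute over both joins, so coefficients of \<open>m\<close> and
  \<open>n\<close> multiply to coefficients over \<alpha> \<circledast> \<beta>. Both membership of
  \<open>Dtens m n\<close> and its behaviour under \<open>Dmap\<close> rest on this.\<close>

lemma val_Dtens_expand:
  assumes m: "m \<in> Obs (Dobj \<alpha>)" and n: "n \<in> Obs (Dobj \<beta>)"
    and v: "\<And>y. y \<in> src \<alpha> \<Longrightarrow> val m y () = (SUP z\<in>tgt \<alpha>. v z * val \<alpha> y z)"
    and w: "\<And>y. y \<in> src \<beta> \<Longrightarrow> val n y () = (SUP z\<in>tgt \<beta>. w z * val \<beta> y z)"
    and p: "p \<in> src (\<alpha> \<circledast> \<beta>)"
  shows "val (Dtens m n) p () = (SUP s\<in>tgt (\<alpha> \<circledast> \<beta>). v (fst s) * w (snd s) * val (\<alpha> \<circledast> \<beta>) p s)"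
proof -
  have p': "p \<in> src \<alpha> \<times> src \<beta>" "fst p \<in> src \<alpha>" "snd p \<in> src \<beta>" using p by auto
  show ?thesis
    unfolding val_Dtens[OF m n p'(1)] v[OF p'(2)] w[OF p'(3)] SUP_mult_SUP tgt_qprod
    by (rule SUP_cong[OF refl]) (simp only: val_qprod[OF p'(1)] ac_simps)
qed

lemma Dtens_in:
  assumes m: "m \<in> Obs (Dobj \<alpha>)" and n: "n \<in> Obs (Dobj \<beta>)"
  shows "Dtens m n \<in> Obs (Dobj (\<alpha> \<circledast> \<beta>))"
proof -
  obtain v where v: "\<And>y. y \<in> src \<alpha> \<Longrightarrow> val m y () = (SUP z\<in>tgt \<alpha>. v z * val \<alpha> y z)"
    using m by (auto simp: Obs_Dobj_iff)
  obtain w where w: "\<And>y. y \<in> src \<beta> \<Longrightarrow> val n y () = (SUP z\<in>tgt \<beta>. w z * val \<beta> y z)"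
    using n by (auto simp: Obs_Dobj_iff)
  have "\<exists>t. \<forall>p\<in>src (\<alpha> \<circledast> \<beta>). val (Dtens m n) p () =
      (SUP s\<in>tgt (\<alpha> \<circledast> \<beta>). t s * val (\<alpha> \<circledast> \<beta>) p s)"
    using val_Dtens_expand[OF m n v w]
    by (intro exI[of _ "\<lambda>s. v (fst s) * w (snd s)"]) blast
  moreover have "src (Dtens m n) = src (\<alpha> \<circledast> \<beta>)" "tgt (Dtens m n) = {()}"
    by (simp_all add: Dtens_def Dobj_src_tgt[OF m] Dobj_src_tgt[OF n])
  ultimately show ?thesis unfolding Obs_Dobj_iff by blast
qed

text \<open>Factorizations multiply: by distributivity, the product of two composites is the
  composite of the products, for the factors on either side.\<close>

lemma dmor_qprod:
  assumes f: "dmor f \<alpha>' \<alpha>" and g: "dmor g \<beta>' \<beta>"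
  shows "dmor (f \<circledast> g) (\<alpha>' \<circledast> \<beta>') (\<alpha> \<circledast> \<beta>)"
proof -
  obtain v u where st: "src f = src \<alpha>'" "tgt f = tgt \<alpha>"
    and v: "\<And>x z. x \<in> src \<alpha>' \<Longrightarrow> z \<in> tgt \<alpha> \<Longrightarrow> val f x z = (SUP y\<in>tgt \<alpha>'. v y z * val \<alpha>' x y)"
    and u: "\<And>x z. x \<in> src \<alpha>' \<Longrightarrow> z \<in> tgt \<alpha> \<Longrightarrow> val f x z = (SUP y\<in>src \<alpha>. val \<alpha> y z * u x y)"
    using f unfolding dmor_iff by blast
  obtain v' u' where st': "src g = src \<beta>'" "tgt g = tgt \<beta>"
    and v': "\<And>x z. x \<in> src \<beta>' \<Longrightarrow> z \<in> tgt \<beta> \<Longrightarrow> val g x z = (SUP y\<in>tgt \<beta>'. v' y z * val \<beta>' x y)"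
    and u': "\<And>x z. x \<in> src \<beta>' \<Longrightarrow> z \<in> tgt \<beta> \<Longrightarrow> val g x z = (SUP y\<in>src \<beta>. val \<beta> y z * u' x y)"
    using g unfolding dmor_iff by blast
  have "val (f \<circledast> g) p s = (SUP y\<in>tgt (\<alpha>' \<circledast> \<beta>').
      v (fst y) (fst s) * v' (snd y) (snd s) * val (\<alpha>' \<circledast> \<beta>') p y)"
    if p: "p \<in> src \<alpha>' \<times> src \<beta>'" and s: "s \<in> tgt \<alpha> \<times> tgt \<beta>" for p s
  proof -
    have *: "fst p \<in> src \<alpha>'" "snd p \<in> src \<beta>'" "fst s \<in> tgt \<alpha>" "snd s \<in> tgt \<beta>" using p s by auto
    have "val (f \<circledast> g) p s = val f (fst p) (fst s) * val g (snd p) (snd s)"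
      using p s st st' by (intro val_qprod) auto
    also have "\<dots> = (SUP y\<in>tgt (\<alpha>' \<circledast> \<beta>').
        v (fst y) (fst s) * v' (snd y) (snd s) * val (\<alpha>' \<circledast> \<beta>') p y)"
      unfolding v[OF *(1,3)] v'[OF *(2,4)] SUP_mult_SUP tgt_qprod
      by (rule SUP_cong[OF refl]) (simp only: val_qprod[OF p] ac_simps)
    finally show ?thesis .
  qed
  moreover have "val (f \<circledast> g) p s = (SUP y\<in>src (\<alpha> \<circledast> \<beta>).
      val (\<alpha> \<circledast> \<beta>) y s * (u (fst p) (fst y) * u' (snd p) (snd y)))"
    if p: "p \<in> src \<alpha>' \<times> src \<beta>'" and s: "s \<in> tgt \<alpha> \<times> tgt \<beta>" for p s
  proof -
    have *: "fst p \<in> src \<alpha>'" "snd p \<in> src \<beta>'" "fst s \<in> tgt \<alpha>" "snd s \<in> tgt \<beta>" using p s by auto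
    have "val (f \<circledast> g) p s = val f (fst p) (fst s) * val g (snd p) (snd s)"
      using p s st st' by (intro val_qprod) auto
    also have "\<dots> = (SUP y\<in>src (\<alpha> \<circledast> \<beta>).
      val (\<alpha> \<circledast> \<beta>) y s * (u (fst p) (fst y) * u' (snd p) (snd y)))"
      unfolding u[OF *(1,3)] u'[OF *(2,4)] SUP_mult_SUP src_qprod
      by (rule SUP_cong[OF refl]) (simp only: val_qprod[OF _ s] ac_simps)
    finally show ?thesis .
  qed
  ultimately show ?thesis
    unfolding dmor_iff
    by (intro conjI exI[of _ "\<lambda>y s. v (fst y) (fst s) * v' (snd y) (snd s)"]
        exI[of _ "\<lambda>p y. u (fst p) (fst y) * u' (snd p) (snd y)"])
      (use st st' in \<open>auto simp del: split_paired_All\<close>)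
qed

text \<open>With coefficients \<open>v\<close> of \<open>m\<close> and \<open>w\<close> of
  \<open>n\<close>, \<open>val_Dmap\<close> evaluates both sides as the product of \<open>v\<close>
  after \<open>f\<close> and \<open>w\<close> after \<open>g\<close>. This is naturality on pure
  tensors.\<close>

lemma Dmap_Dtens:
  assumes f: "dmor f \<alpha>' \<alpha>" and g: "dmor g \<beta>' \<beta>"
    and m: "m \<in> Obs (Dobj \<alpha>)" and n: "n \<in> Obs (Dobj \<beta>)"
  shows "Dmap (\<alpha> \<circledast> \<beta>) (f \<circledast> g) (Dtens m n) = Dtens (Dmap \<alpha> f m) (Dmap \<beta> g n)"
proof (rule Dobj_eqI)
  obtain v where v: "\<And>y. y \<in> src \<alpha> \<Longrightarrow> val m y () = (SUP z\<in>tgt \<alpha>. v z * val \<alpha> y z)"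
    using m by (auto simp: Obs_Dobj_iff)
  obtain w where w: "\<And>y. y \<in> src \<beta> \<Longrightarrow> val n y () = (SUP z\<in>tgt \<beta>. w z * val \<beta> y z)"
    using n by (auto simp: Obs_Dobj_iff)
  have st: "src f = src \<alpha>'" "tgt f = tgt \<alpha>" "src g = src \<beta>'" "tgt g = tgt \<beta>"
    using f g by (auto simp: dmor_def)
  show "Dmap (\<alpha> \<circledast> \<beta>) (f \<circledast> g) (Dtens m n) \<in> Obs (Dobj (\<alpha>' \<circledast> \<beta>'))"
    by (rule qsup_mor_in[OF qsup_mor_Dmap[OF dmor_qprod[OF f g]] Dtens_in[OF m n]])
  have fm: "Dmap \<alpha> f m \<in> Obs (Dobj \<alpha>')" by (rule qsup_mor_in[OF qsup_mor_Dmap[OF f] m])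
  have gn: "Dmap \<beta> g n \<in> Obs (Dobj \<beta>')" by (rule qsup_mor_in[OF qsup_mor_Dmap[OF g] n])
  show "Dtens (Dmap \<alpha> f m) (Dmap \<beta> g n) \<in> Obs (Dobj (\<alpha>' \<circledast> \<beta>'))" by (rule Dtens_in[OF fm gn])
  fix p assume p: "p \<in> src (\<alpha>' \<circledast> \<beta>')"
  then have p': "p \<in> src \<alpha>' \<times> src \<beta>'" "fst p \<in> src \<alpha>'" "snd p \<in> src \<beta>'" by auto
  have fg: "p \<in> src f \<times> src g" using p st by simp
  have "val (Dmap (\<alpha> \<circledast> \<beta>) (f \<circledast> g) (Dtens m n)) p () =
      (SUP s\<in>tgt (\<alpha> \<circledast> \<beta>). v (fst s) * w (snd s) * val (f \<circledast> g) p s)"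
    by (rule val_Dmap[OF dmor_qprod[OF f g] Dtens_in[OF m n] val_Dtens_expand[OF m n v w] p])
  also have "\<dots> = (SUP z\<in>tgt \<alpha>. v z * val f (fst p) z) * (SUP z\<in>tgt \<beta>. w z * val g (snd p) z)"
    unfolding SUP_mult_SUP tgt_qprod
    by (rule SUP_cong[OF refl]) (simp only: val_qprod[OF fg, unfolded st] ac_simps)
  also have "\<dots> = val (Dmap \<alpha> f m) (fst p) () * val (Dmap \<beta> g n) (snd p) ()"
    using val_Dmap[OF f m v p'(2)] val_Dmap[OF g n w p'(3)] by simp
  also have "\<dots> = val (Dtens (Dmap \<alpha> f m) (Dmap \<beta> g n)) p ()"
    by (rule val_Dtens[OF fm gn p'(1), symmetric])
  finally show "val (Dmap (\<alpha> \<circledast> \<beta>) (f \<circledast> g) (Dtens m n)) p () =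
      val (Dtens (Dmap \<alpha> f m) (Dmap \<beta> g n)) p ()" .
qed


section \<open>The isomorphism for regular relations\<close>

text \<open>Regularity reads \<alpha> = \<alpha> \<circ> (\<gamma> \<circ> \<alpha>), which expands
  every column of \<alpha> in the elements \<open>E z\<close>; these lie in D \<alpha> since the
  values \<open>val \<gamma> y z\<close> serve as coefficients.\<close>

lemma regular_basis:
  assumes "regular \<alpha>"
  obtains E where "\<And>z. z \<in> src \<alpha> \<Longrightarrow> E z \<in> Obs (Dobj \<alpha>)"
    and "\<And>x y. x \<in> src \<alpha> \<Longrightarrow> y \<in> tgt \<alpha> \<Longrightarrow>
      val \<alpha> x y = (SUP z\<in>src \<alpha>. val \<alpha> z y * val (E z) x ())"
proof -
  obtain \<gamma> where \<gamma>: "src \<gamma> = tgt \<alpha>" "tgt \<gamma> = src \<alpha>" "\<alpha> = qcomp \<alpha> (qcomp \<gamma> \<alpha>)"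
    using assms by (auto simp: regular_def)
  define E where "E z = Qrel (src \<alpha>) {()} (\<lambda>x _. SUP y\<in>tgt \<alpha>. val \<gamma> y z * val \<alpha> x y)" for z
  have "E z \<in> Obs (Dobj \<alpha>)" for z
    by (auto simp: Obs_Dobj_iff E_def)
  moreover have "val \<alpha> x y = (SUP z\<in>src \<alpha>. val \<alpha> z y * val (E z) x ())"
    if "x \<in> src \<alpha>" "y \<in> tgt \<alpha>" for x y
    using arg_cong[OF \<gamma>(3), of "\<lambda>\<alpha>. val \<alpha> x y"] that \<gamma>(1,2)
    by (simp add: qcomp_def E_def)
  ultimately show thesis using that by blast
qed

text \<open>The expansion of the columns of \<alpha> extends to their weighted joins; the coordinate
  of \<open>m\<close> at \<open>E z\<close> is just its value at \<open>z\<close>.\<close>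

lemma basis_expand:
  assumes E: "\<And>x y. x \<in> src \<alpha> \<Longrightarrow> y \<in> tgt \<alpha> \<Longrightarrow>
      val \<alpha> x y = (SUP z\<in>src \<alpha>. val \<alpha> z y * val (E z) x ())"
    and m: "m \<in> Obs (Dobj \<alpha>)" and x: "x \<in> src \<alpha>"
  shows "val m x () = (SUP z\<in>src \<alpha>. val m z () * val (E z) x ())"
proof -
  obtain v where v: "\<And>y. y \<in> src \<alpha> \<Longrightarrow> val m y () = (SUP z\<in>tgt \<alpha>. v z * val \<alpha> y z)"
    using m by (auto simp: Obs_Dobj_iff)
  have "val m x () = (SUP y\<in>tgt \<alpha>. v y * (SUP z\<in>src \<alpha>. val \<alpha> z y * val (E z) x ()))"
    unfolding v[OF x] by (rule SUP_cong[OF refl]) (simp add: E[OF x, symmetric])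
  also have "\<dots> = (SUP z\<in>src \<alpha>. val m z () * val (E z) x ())"
    by (simp add: v mult_SUP SUP_mult mult.assoc SUP_commute[of _ "tgt \<alpha>"] cong: SUP_cong)
  finally show ?thesis .
qed

text \<open>Homs into a fixed \<open>n\<close> turn weighted joins into weighted infima, so lower
  bounds on them can be tested on the basis alone.\<close>

lemma le_Hom_basis_iff:
  assumes E: "\<And>z. z \<in> src \<alpha> \<Longrightarrow> E z \<in> Obs (Dobj \<alpha>)"
    "\<And>x y. x \<in> src \<alpha> \<Longrightarrow> y \<in> tgt \<alpha> \<Longrightarrow>
      val \<alpha> x y = (SUP z\<in>src \<alpha>. val \<alpha> z y * val (E z) x ())"
    and m: "m \<in> Obs (Dobj \<alpha>)" and n: "n \<in> Obs (Dobj \<alpha>)"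
  shows "q \<le> Hom (Dobj \<alpha>) m n \<longleftrightarrow> (\<forall>z\<in>src \<alpha>. q * val m z () \<le> Hom (Dobj \<alpha>) (E z) n)"
proof -
  have "q \<le> Hom (Dobj \<alpha>) m n \<longleftrightarrow>
      (\<forall>x\<in>src \<alpha>. (SUP z\<in>src \<alpha>. val m z () * val (E z) x ()) * q \<le> val n x ())"
    unfolding le_Hom_Dobj_iff[OF m n] using basis_expand[OF E(2) m] by simp
  also have "\<dots> \<longleftrightarrow> (\<forall>z\<in>src \<alpha>. q * val m z () \<le> Hom (Dobj \<alpha>) (E z) n)"
    using E(1) n by (auto simp: SUP_mult_le_iff le_Hom_Dobj_iff mult.left_commute mult.commute[of q] mult.assoc)
  finally show ?thesis .
qed

text \<open>Multiplying the two column expansions gives a join over pairs, whose terms regroup into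
  values of \<alpha> \<circledast> \<beta> and products of basis elements.
  \<open>basis_expand\<close> then applies to concepts of \<alpha> \<circledast> \<beta>.\<close>

lemma regular_qprod_basis:
  assumes E: "\<And>x y. x \<in> src \<alpha> \<Longrightarrow> y \<in> tgt \<alpha> \<Longrightarrow>
      val \<alpha> x y = (SUP z\<in>src \<alpha>. val \<alpha> z y * val (E z) x ())"
    and E': "\<And>x y. x \<in> src \<beta> \<Longrightarrow> y \<in> tgt \<beta> \<Longrightarrow>
      val \<beta> x y = (SUP z\<in>src \<beta>. val \<beta> z y * val (E' z) x ())"
    and E_in: "\<And>z. z \<in> src \<alpha> \<Longrightarrow> E z \<in> Obs (Dobj \<alpha>)"
    and E'_in: "\<And>z. z \<in> src \<beta> \<Longrightarrow> E' z \<in> Obs (Dobj \<beta>)"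
    and p: "p \<in> src (\<alpha> \<circledast> \<beta>)" and s: "s \<in> tgt (\<alpha> \<circledast> \<beta>)"
  shows "val (\<alpha> \<circledast> \<beta>) p s =
      (SUP z\<in>src (\<alpha> \<circledast> \<beta>). val (\<alpha> \<circledast> \<beta>) z s * val (Dtens (E (fst z)) (E' (snd z))) p ())"
proof -
  have p': "p \<in> src \<alpha> \<times> src \<beta>" "fst p \<in> src \<alpha>" "snd p \<in> src \<beta>"
    and s': "s \<in> tgt \<alpha> \<times> tgt \<beta>" "fst s \<in> tgt \<alpha>" "snd s \<in> tgt \<beta>" using p s by auto
  have "val (\<alpha> \<circledast> \<beta>) p s = (SUP z\<in>src \<alpha> \<times> src \<beta>.
      val \<alpha> (fst z) (fst s) * val (E (fst z)) (fst p) () *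
      (val \<beta> (snd z) (snd s) * val (E' (snd z)) (snd p) ()))"
    unfolding val_qprod[OF p'(1) s'(1)]
    by (subst E[OF p'(2) s'(2)], subst E'[OF p'(3) s'(3)]) (rule SUP_mult_SUP)
  also have "\<dots> =
      (SUP z\<in>src (\<alpha> \<circledast> \<beta>). val (\<alpha> \<circledast> \<beta>) z s * val (Dtens (E (fst z)) (E' (snd z))) p ())"
    unfolding src_qprod
  proof (rule SUP_cong[OF refl])
    fix z assume z: "z \<in> src \<alpha> \<times> src \<beta>"
    then have "E (fst z) \<in> Obs (Dobj \<alpha>)" "E' (snd z) \<in> Obs (Dobj \<beta>)" using E_in E'_in by auto
    then show "val \<alpha> (fst z) (fst s) * val (E (fst z)) (fst p) () *
        (val \<beta> (snd z) (snd s) * val (E' (snd z)) (snd p) ()) =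
        val (\<alpha> \<circledast> \<beta>) z s * val (Dtens (E (fst z)) (E' (snd z))) p ()"
      by (simp only: val_qprod[OF z s'(1)] val_Dtens[OF _ _ p'(1)] ac_simps)
  qed
  finally show ?thesis .
qed

section \<open>The comparison map and its right adjoint\<close>

text \<open>This is the map induced by the bimorphism \<open>Dtens\<close>, given as an explicit
  weighted join so that its values can be computed directly.\<close>

definition Dtheta :: "('x, 'y, 'q::comm_unital_quantale) qrel \<Rightarrow> ('u, 'v, 'q) qrel \<Rightarrow>
    (('x, unit, 'q) qrel \<times> ('u, unit, 'q) qrel \<Rightarrow> 'q) \<Rightarrow> ('x \<times> 'u, unit, 'q) qrel"
  where "Dtheta \<alpha> \<beta> \<phi> = Dsup (src (\<alpha> \<circledast> \<beta>)) (Obs (Dobj \<alpha>) \<times> Obs (Dobj \<beta>)) \<phi>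
    (\<lambda>l. Dtens (fst l) (snd l))"

text \<open>The candidate inverse is the right adjoint of \<open>Dtheta\<close>; that it is inverse
  will come from regularity.\<close>

definition Dtheta_inv :: "('x, 'y, 'q::comm_unital_quantale) qrel \<Rightarrow> ('u, 'v, 'q) qrel \<Rightarrow>
    ('x \<times> 'u, unit, 'q) qrel \<Rightarrow> ('x, unit, 'q) qrel \<times> ('u, unit, 'q) qrel \<Rightarrow> 'q"
  where "Dtheta_inv \<alpha> \<beta> M = (\<lambda>l\<in>Obs (Dobj \<alpha>) \<times> Obs (Dobj \<beta>).
    Hom (Dobj (\<alpha> \<circledast> \<beta>)) (Dtens (fst l) (snd l)) M)"

lemma mult_bot: "a * bot = (bot :: 'q::comm_unital_quantale)"
  using mult_SUP[of a "\<lambda>x. x" "{}"] by simp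

lemma SUP_mult_delta:
  assumes "y \<in> Y"
  shows "(SUP z\<in>Y. f z * (if z = y then c else bot)) = f y * (c :: 'q::comm_unital_quantale)"
  using assms by (intro antisym SUP_least SUP_upper2[of y]) (auto simp: mult_bot)

lemma bimorphism_Dtens: "bimorphism (Dobj \<alpha>) (Dobj \<beta>) (Dobj (\<alpha> \<circledast> \<beta>)) Dtens"
  unfolding bimorphism_def
proof (intro conjI ballI)
  fix n assume n: "n \<in> Obs (Dobj \<beta>)"
  \<comment> \<open>With \<open>n\<close> fixed, the matrix is a multiple of a Kronecker delta: it
    reads off the value of the argument at \<open>fst p\<close> and multiplies it by
    \<open>val n (snd p) ()\<close>.\<close>
  show "qsup_mor (Dobj \<alpha>) (Dobj (\<alpha> \<circledast> \<beta>)) (\<lambda>m. Dtens m n)"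
    by (rule qsup_mor_Dobj[where k = "\<lambda>p y. if y = fst p then val n (snd p) () else bot"])
      (auto simp: Dtens_in val_Dtens[OF _ n] SUP_mult_delta n)
next
  fix m assume m: "m \<in> Obs (Dobj \<alpha>)"
  show "qsup_mor (Dobj \<beta>) (Dobj (\<alpha> \<circledast> \<beta>)) (Dtens m)"
    by (rule qsup_mor_Dobj[where k = "\<lambda>p y. if y = snd p then val m (fst p) () else bot"])
      (auto simp: Dtens_in val_Dtens[OF m] SUP_mult_delta m mult.commute)
qed

lemma Dtheta_in: "Dtheta \<alpha> \<beta> \<phi> \<in> Obs (Dobj (\<alpha> \<circledast> \<beta>))"
  unfolding Dtheta_def by (rule Dsup_in) (auto intro: Dtens_in)

text \<open>\<open>Dtens\<close> has a right adjoint \<open>R\<close> in each variable, and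
  \<open>R M\<close> is the element that represents the map in that variable.\<close>

lemma Dtheta_inv_in:
  assumes M: "M \<in> Obs (Dobj (\<alpha> \<circledast> \<beta>))"
  shows "Dtheta_inv \<alpha> \<beta> M \<in> Obs (qtensor (Dobj \<alpha>) (Dobj \<beta>))"
proof -
  let ?D = "Dobj (\<alpha> \<circledast> \<beta>)"
  have "\<exists>a\<in>Obs (Dobj \<alpha>). \<forall>m\<in>Obs (Dobj \<alpha>). Hom ?D (Dtens m n) M = Hom (Dobj \<alpha>) m a"
    if "n \<in> Obs (Dobj \<beta>)" for n
  proof -
    obtain R where "adjunction (Dobj \<alpha>) ?D (\<lambda>m. Dtens m n) R"
      using bimorphism_Dtens[of \<alpha> \<beta>] \<open>n \<in> _\<close> by (auto simp: bimorphism_def qsup_mor_def)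
    then show ?thesis
      using M by (intro bexI[of _ "R M"]) (auto simp: adjunction_def qfunctor_def)
  qed
  moreover have "\<exists>b\<in>Obs (Dobj \<beta>). \<forall>n\<in>Obs (Dobj \<beta>). Hom ?D (Dtens m n) M = Hom (Dobj \<beta>) n b"
    if "m \<in> Obs (Dobj \<alpha>)" for m
  proof -
    obtain R where "adjunction (Dobj \<beta>) ?D (Dtens m) R"
      using bimorphism_Dtens[of \<alpha> \<beta>] \<open>m \<in> _\<close> by (auto simp: bimorphism_def qsup_mor_def)
    then show ?thesis
      using M by (intro bexI[of _ "R M"]) (auto simp: adjunction_def qfunctor_def)
  qed
  ultimately show ?thesis by (simp add: qtensor_def Dtheta_inv_def)
qed

text \<open>Mapping out of the weighted join unfolds to the infimum over all pairs of
  \<open>\<phi>\<close> residuated into \<open>Dtheta_inv \<alpha> \<beta> M\<close>, which is the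
  hom of the tensor product.\<close>

lemma Dtheta_adjoint:
  assumes M: "M \<in> Obs (Dobj (\<alpha> \<circledast> \<beta>))"
  shows "Hom (Dobj (\<alpha> \<circledast> \<beta>)) (Dtheta \<alpha> \<beta> \<phi>) M =
    Hom (qtensor (Dobj \<alpha>) (Dobj \<beta>)) \<phi> (Dtheta_inv \<alpha> \<beta> M)"
  unfolding Dtheta_def
  by (subst Hom_Dsup[OF _ M]) (auto simp: qtensor_def Dtheta_inv_def intro: Dtens_in cong: INF_cong)

lemma qsup_mor_Dtheta:
  "qsup_mor (qtensor (Dobj \<alpha>) (Dobj \<beta>)) (Dobj (\<alpha> \<circledast> \<beta>)) (Dtheta \<alpha> \<beta>)"
proof -
  have "adjunction (qtensor (Dobj \<alpha>) (Dobj \<beta>)) (Dobj (\<alpha> \<circledast> \<beta>)) (Dtheta \<alpha> \<beta>) (Dtheta_inv \<alpha> \<beta>)"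
    by (rule adjunctionI[OF qcategory_qtensor qcategory_Dobj])
      (auto simp: Dtheta_in Dtheta_inv_in Dtheta_adjoint)
  then show ?thesis
    using qsup_object_Dobj qsup_object_qtensor[OF qsup_object_Dobj qsup_object_Dobj]
    by (auto simp: qsup_mor_def)
qed

text \<open>The two concepts have equal homs into every \<open>M\<close>: by adjointness and the
  property \<open>Hom_pure_tensor\<close>, both are the value of
  \<open>Dtheta_inv \<alpha> \<beta> M\<close> at \<open>(m, n)\<close>.\<close>

lemma Dtheta_pure_tensor:
  assumes m: "m \<in> Obs (Dobj \<alpha>)" and n: "n \<in> Obs (Dobj \<beta>)"
  shows "Dtheta \<alpha> \<beta> (pure_tensor (Dobj \<alpha>) (Dobj \<beta>) m n) = Dtens m n"
proof (rule skeletal_eqI[OF qcategory_Dobj _ Dtheta_in Dtens_in[OF m n]])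
  show "skeletal (Dobj (\<alpha> \<circledast> \<beta>))" using qsup_object_Dobj by (auto simp: qsup_object_def)
  fix M assume M: "M \<in> Obs (Dobj (\<alpha> \<circledast> \<beta>))"
  show "Hom (Dobj (\<alpha> \<circledast> \<beta>)) (Dtheta \<alpha> \<beta> (pure_tensor (Dobj \<alpha>) (Dobj \<beta>) m n)) M =
      Hom (Dobj (\<alpha> \<circledast> \<beta>)) (Dtens m n) M"
    using m n by (simp add: Dtheta_adjoint[OF M]
      Hom_pure_tensor[OF qsup_object_Dobj qsup_object_Dobj m n Dtheta_inv_in[OF M]])
      (simp add: Dtheta_inv_def)
qed

section \<open>Invertibility in the regular case\<close>

text \<open>One inequality is the counit of the adjunction. For the other, \<open>M\<close> is the
  join of the basis elements \<open>?e z\<close> weighted by \<open>val M z ()\<close>, and these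
  weights are below \<open>Hom ?D (?e z) M\<close>, so the basis terms of the join already reach
  \<open>M\<close>.\<close>

lemma Dtheta_Dtheta_inv:
  assumes \<alpha>: "regular \<alpha>" and \<beta>: "regular \<beta>" and M: "M \<in> Obs (Dobj (\<alpha> \<circledast> \<beta>))"
  shows "Dtheta \<alpha> \<beta> (Dtheta_inv \<alpha> \<beta> M) = M"
proof (rule Dobj_eqI[OF Dtheta_in M])
  obtain E where E: "\<And>z. z \<in> src \<alpha> \<Longrightarrow> E z \<in> Obs (Dobj \<alpha>)"
    "\<And>x y. x \<in> src \<alpha> \<Longrightarrow> y \<in> tgt \<alpha> \<Longrightarrow> val \<alpha> x y = (SUP z\<in>src \<alpha>. val \<alpha> z y * val (E z) x ())"
    using regular_basis[OF \<alpha>] by blast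
  obtain E' where E': "\<And>z. z \<in> src \<beta> \<Longrightarrow> E' z \<in> Obs (Dobj \<beta>)"
    "\<And>x y. x \<in> src \<beta> \<Longrightarrow> y \<in> tgt \<beta> \<Longrightarrow> val \<beta> x y = (SUP z\<in>src \<beta>. val \<beta> z y * val (E' z) x ())"
    using regular_basis[OF \<beta>] by blast
  let ?D = "Dobj (\<alpha> \<circledast> \<beta>)" and ?I = "Obs (Dobj \<alpha>) \<times> Obs (Dobj \<beta>)"
  let ?e = "\<lambda>z. Dtens (E (fst z)) (E' (snd z))"
  have expand: "val M x () = (SUP z\<in>src (\<alpha> \<circledast> \<beta>). val M z () * val (?e z) x ())"
    if "x \<in> src (\<alpha> \<circledast> \<beta>)" for x
    by (rule basis_expand[OF _ M that])
      (rule regular_qprod_basis[OF E(2) E'(2) E(1) E'(1)])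
  fix p assume p: "p \<in> src (\<alpha> \<circledast> \<beta>)"
  have theta: "val (Dtheta \<alpha> \<beta> (Dtheta_inv \<alpha> \<beta> M)) p () =
      (SUP l\<in>?I. Hom ?D (Dtens (fst l) (snd l)) M * val (Dtens (fst l) (snd l)) p ())"
    using p by (simp add: Dtheta_def Dtheta_inv_def cong: SUP_cong)
  show "val (Dtheta \<alpha> \<beta> (Dtheta_inv \<alpha> \<beta> M)) p () = val M p ()"
  proof (rule antisym)
    have "val (Dtens m n) p () * Hom ?D (Dtens m n) M \<le> val M p ()"
      if "m \<in> Obs (Dobj \<alpha>)" "n \<in> Obs (Dobj \<beta>)" for m n
      using le_Hom_Dobj_iff[OF Dtens_in[OF that] M, THEN iffD1, OF order_refl] p by blast
    then show "val (Dtheta \<alpha> \<beta> (Dtheta_inv \<alpha> \<beta> M)) p () \<le> val M p ()"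
      unfolding theta by (auto intro!: SUP_least simp: mult.commute)
    show "val M p () \<le> val (Dtheta \<alpha> \<beta> (Dtheta_inv \<alpha> \<beta> M)) p ()"
      unfolding expand[OF p]
    proof (rule SUP_least)
      fix z assume z: "z \<in> src (\<alpha> \<circledast> \<beta>)"
      then have I: "(E (fst z), E' (snd z)) \<in> ?I" using E(1) E'(1) by auto
      then have e: "?e z \<in> Obs ?D" by (auto intro: Dtens_in)
      have "val M z () \<le> Hom ?D (?e z) M"
        unfolding le_Hom_Dobj_iff[OF e M]
      proof
        fix x assume x: "x \<in> src (\<alpha> \<circledast> \<beta>)"
        show "val (?e z) x () * val M z () \<le> val M x ()"
          unfolding expand[OF x] using z by (subst mult.commute) (rule SUP_upper)
      qed
      then have "val M z () * val (?e z) p () \<le> Hom ?D (?e z) M * val (?e z) p ()"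
        by (rule q_mult_mono) simp
      also have "\<dots> \<le> val (Dtheta \<alpha> \<beta> (Dtheta_inv \<alpha> \<beta> M)) p ()"
        unfolding theta by (rule order_trans[OF _ SUP_upper[OF I]]) simp
      finally show "val M z () * val (?e z) p () \<le> val (Dtheta \<alpha> \<beta> (Dtheta_inv \<alpha> \<beta> M)) p ()" .
    qed
  qed
qed

text \<open>One inequality is the unit. The other holds since \<open>\<phi>\<close>, being
  representable in each variable, is determined by its values on pairs of basis elements.\<close>

lemma Dtheta_inv_Dtheta:
  assumes \<alpha>: "regular \<alpha>" and \<beta>: "regular \<beta>"
    and \<phi>: "\<phi> \<in> Obs (qtensor (Dobj \<alpha>) (Dobj \<beta>))"
  shows "Dtheta_inv \<alpha> \<beta> (Dtheta \<alpha> \<beta> \<phi>) = \<phi>"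
proof (rule extensionalityI)
  let ?T = "qtensor (Dobj \<alpha>) (Dobj \<beta>)" and ?D = "Dobj (\<alpha> \<circledast> \<beta>)"
  let ?I = "Obs (Dobj \<alpha>) \<times> Obs (Dobj \<beta>)"
  show "Dtheta_inv \<alpha> \<beta> (Dtheta \<alpha> \<beta> \<phi>) \<in> extensional ?I" "\<phi> \<in> extensional ?I"
    using \<phi> by (auto simp: Dtheta_inv_def qtensor_def)
  obtain E where E: "\<And>z. z \<in> src \<alpha> \<Longrightarrow> E z \<in> Obs (Dobj \<alpha>)"
    "\<And>x y. x \<in> src \<alpha> \<Longrightarrow> y \<in> tgt \<alpha> \<Longrightarrow> val \<alpha> x y = (SUP z\<in>src \<alpha>. val \<alpha> z y * val (E z) x ())"
    using regular_basis[OF \<alpha>] by blast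
  obtain E' where E': "\<And>z. z \<in> src \<beta> \<Longrightarrow> E' z \<in> Obs (Dobj \<beta>)"
    "\<And>x y. x \<in> src \<beta> \<Longrightarrow> y \<in> tgt \<beta> \<Longrightarrow> val \<beta> x y = (SUP z\<in>src \<beta>. val \<beta> z y * val (E' z) x ())"
    using regular_basis[OF \<beta>] by blast
  have left: "q \<le> \<phi> (m, n) \<longleftrightarrow> (\<forall>z\<in>src \<alpha>. q * val m z () \<le> \<phi> (E z, n))"
    if m: "m \<in> Obs (Dobj \<alpha>)" and n: "n \<in> Obs (Dobj \<beta>)" for q m n
  proof -
    obtain a where "a \<in> Obs (Dobj \<alpha>)" "\<And>m. m \<in> Obs (Dobj \<alpha>) \<Longrightarrow> \<phi> (m, n) = Hom (Dobj \<alpha>) m a"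
      using \<phi> n by (auto simp: qtensor_def)
    then show ?thesis using le_Hom_basis_iff[OF E m, of a q] m E(1) by simp
  qed
  have right: "q \<le> \<phi> (m, n) \<longleftrightarrow> (\<forall>z\<in>src \<beta>. q * val n z () \<le> \<phi> (m, E' z))"
    if m: "m \<in> Obs (Dobj \<alpha>)" and n: "n \<in> Obs (Dobj \<beta>)" for q m n
  proof -
    obtain b where "b \<in> Obs (Dobj \<beta>)" "\<And>n. n \<in> Obs (Dobj \<beta>) \<Longrightarrow> \<phi> (m, n) = Hom (Dobj \<beta>) n b"
      using \<phi> m by (auto simp: qtensor_def)
    then show ?thesis using le_Hom_basis_iff[OF E' n, of b q] n E'(1) by simp
  qed
  \<comment> \<open>The two one-variable tests combine: first \<open>m\<close> is expanded in the
    basis \<open>E\<close>, then \<open>n\<close> in \<open>E'\<close> with \<open>E z\<close> in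
    the first place.\<close>
  have both: "q \<le> \<phi> (m, n) \<longleftrightarrow>
      (\<forall>z\<in>src \<alpha>. \<forall>z'\<in>src \<beta>. q * (val m z () * val n z' ()) \<le> \<phi> (E z, E' z'))"
    if m: "m \<in> Obs (Dobj \<alpha>)" and n: "n \<in> Obs (Dobj \<beta>)" for q m n
    using left[OF m n, of q] right[OF E(1) n] by (simp add: mult.assoc)
  fix l assume l: "l \<in> ?I"
  then obtain m n where mn: "l = (m, n)" "m \<in> Obs (Dobj \<alpha>)" "n \<in> Obs (Dobj \<beta>)" by auto
  let ?h = "Hom ?D (Dtens m n) (Dtheta \<alpha> \<beta> \<phi>)"
  have "?h = \<phi> (m, n)"
  proof (rule antisym)
    have "?h * (val m z () * val n z' ()) \<le> \<phi> (E z, E' z')"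
      if z: "z \<in> src \<alpha>" and z': "z' \<in> src \<beta>" for z z'
    proof -
      have "(z, z') \<in> src (\<alpha> \<circledast> \<beta>)" using z z' by simp
      then have "val (Dtens m n) (z, z') () * ?h \<le> val (Dtheta \<alpha> \<beta> \<phi>) (z, z') ()"
        using le_Hom_Dobj_iff[OF Dtens_in[OF mn(2,3)] Dtheta_in, THEN iffD1, OF order_refl] by blast
      \<comment> \<open>Evaluated at \<open>(z, z')\<close>, \<open>Dtheta\<close> is a join over
        all pairs of concepts, and each term is bounded by \<open>both\<close> with \<open>q\<close>
        the value of \<open>\<phi>\<close> at that pair.\<close>
      also have "\<dots> \<le> \<phi> (E z, E' z')"
        using z z' both[THEN iffD1, OF _ _ order_refl] by (auto simp: Dtheta_def val_Dtens intro!: SUP_least)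
      finally show ?thesis using z z' by (simp add: val_Dtens[OF mn(2,3)] mult.commute)
    qed
    then show "?h \<le> \<phi> (m, n)" using both[OF mn(2,3)] by blast
    have "1 \<le> Hom ?T \<phi> (Dtheta_inv \<alpha> \<beta> (Dtheta \<alpha> \<beta> \<phi>))"
      using Dtheta_adjoint[OF Dtheta_in[of \<alpha> \<beta> \<phi>], of \<phi>] qcat_refl[OF qcategory_Dobj Dtheta_in[of \<alpha> \<beta> \<phi>]]
      by simp
    then have "\<phi> l \<le> Dtheta_inv \<alpha> \<beta> (Dtheta \<alpha> \<beta> \<phi>) l"
      using l by (auto simp: qtensor_def le_INF_qimp_iff)
    then show "\<phi> (m, n) \<le> ?h" using mn by (simp add: Dtheta_inv_def)
  qed
  then show "Dtheta_inv \<alpha> \<beta> (Dtheta \<alpha> \<beta> \<phi>) l = \<phi> l" using mn by (simp add: Dtheta_inv_def)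
qed

lemma qsup_iso_Dtheta:
  assumes \<alpha>: "regular \<alpha>" and \<beta>: "regular \<beta>"
  shows "qsup_iso (qtensor (Dobj \<alpha>) (Dobj \<beta>)) (Dobj (\<alpha> \<circledast> \<beta>)) (Dtheta \<alpha> \<beta>)"
proof -
  let ?T = "qtensor (Dobj \<alpha>) (Dobj \<beta>)" and ?D = "Dobj (\<alpha> \<circledast> \<beta>)"
  have "adjunction ?D ?T (Dtheta_inv \<alpha> \<beta>) (Dtheta \<alpha> \<beta>)"
  proof (rule adjunctionI[OF qcategory_Dobj qcategory_qtensor])
    \<comment> \<open>\<open>Dtheta\<close> preserves homs exactly, so its two-sided inverse is
      adjoint to it on the other side as well.\<close>
    have full: "Hom ?T \<phi> \<psi> = Hom ?D (Dtheta \<alpha> \<beta> \<phi>) (Dtheta \<alpha> \<beta> \<psi>)" if "\<psi> \<in> Obs ?T" for \<phi> \<psi>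
      using Dtheta_adjoint[OF Dtheta_in] Dtheta_inv_Dtheta[OF \<alpha> \<beta> that] by metis
    show "Hom ?T (Dtheta_inv \<alpha> \<beta> M) \<phi> = Hom ?D M (Dtheta \<alpha> \<beta> \<phi>)"
      if "M \<in> Obs ?D" "\<phi> \<in> Obs ?T" for M \<phi>
      using full[OF that(2)] Dtheta_Dtheta_inv[OF \<alpha> \<beta> that(1)] by simp
  qed (auto simp: Dtheta_in Dtheta_inv_in)
  then have "qsup_mor ?D ?T (Dtheta_inv \<alpha> \<beta>)"
    using qsup_mor_Dtheta[of \<alpha> \<beta>] by (auto simp: qsup_mor_def)
  then show ?thesis
    using qsup_mor_Dtheta Dtheta_Dtheta_inv[OF \<alpha> \<beta>] Dtheta_inv_Dtheta[OF \<alpha> \<beta>]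
    unfolding qsup_iso_def by blast
qed

section \<open>Naturality of the comparison map\<close>

lemma qsup_mor_cong:
  assumes F: "qsup_mor A B F" and eq: "\<And>a. a \<in> Obs A \<Longrightarrow> F a = F' a"
  shows "qsup_mor A B F'"
proof -
  obtain G where "adjunction A B F G" using F by (auto simp: qsup_mor_def)
  then have "adjunction A B F' G" using eq by (auto simp: adjunction_def qfunctor_def Pi_iff)
  then show ?thesis using F by (auto simp: qsup_mor_def)
qed

text \<open>This is uniqueness in the universal property, applied to the bimorphism that
  \<open>H\<close> induces on pure tensors.\<close>

lemma qtensor_mor_eqI:
  assumes A: "qsup_object A" and B: "qsup_object B"
    and H: "qsup_mor (qtensor A B) C H" and K: "qsup_mor (qtensor A B) C K"
    and eq: "\<And>a b. a \<in> Obs A \<Longrightarrow> b \<in> Obs B \<Longrightarrow> H (pure_tensor A B a b) = K (pure_tensor A B a b)"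
    and \<phi>: "\<phi> \<in> Obs (qtensor A B)"
  shows "H \<phi> = K \<phi>"
proof -
  let ?T = "qtensor A B"
  have bi: "bimorphism A B C (\<lambda>a b. H (pure_tensor A B a b))"
    using bimorphism_pure_tensor[OF A B] by (auto simp: bimorphism_def intro!: qsup_mor_comp[OF _ H])
  \<comment> \<open>Uniqueness is stated for extensional maps, hence the restrictions.\<close>
  have "qsup_mor ?T C (restrict H (Obs ?T))" "qsup_mor ?T C (restrict K (Obs ?T))"
    by (auto intro: qsup_mor_cong[OF H] qsup_mor_cong[OF K])
  then have "restrict H (Obs ?T) = restrict K (Obs ?T)"
    using eq pure_tensor_in[OF A B]
    by (intro Uniq_D[OF conjunct2[OF qtensor_factorization[OF A B bi, unfolded ex1_iff_ex_Uniq]]]) simp_all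
  then show ?thesis using \<phi> by (metis restrict_apply')
qed

text \<open>Both sides are composites of morphisms out of the tensor product, so pure tensors
  suffice; there \<open>Dmap_Dtens\<close> applies.\<close>

lemma Dtheta_natural:
  assumes f: "dmor f \<alpha>' \<alpha>" and g: "dmor g \<beta>' \<beta>"
    and \<phi>: "\<phi> \<in> Obs (qtensor (Dobj \<alpha>) (Dobj \<beta>))"
  shows "Dtheta \<alpha>' \<beta>' (qtensor_map (Dobj \<alpha>) (Dobj \<beta>) (Dobj \<alpha>') (Dobj \<beta>') (Dmap \<alpha> f) (Dmap \<beta> g) \<phi>)
    = Dmap (\<alpha> \<circledast> \<beta>) (f \<circledast> g) (Dtheta \<alpha> \<beta> \<phi>)"
proof (rule qtensor_mor_eqI[OF qsup_object_Dobj qsup_object_Dobj _ _ _ \<phi>])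
  note F = qsup_mor_Dmap[OF f] and G = qsup_mor_Dmap[OF g]
  show "qsup_mor (qtensor (Dobj \<alpha>) (Dobj \<beta>)) (Dobj (\<alpha>' \<circledast> \<beta>')) (\<lambda>\<phi>. Dtheta \<alpha>' \<beta>'
      (qtensor_map (Dobj \<alpha>) (Dobj \<beta>) (Dobj \<alpha>') (Dobj \<beta>') (Dmap \<alpha> f) (Dmap \<beta> g) \<phi>))"
    by (rule qsup_mor_comp[OF qtensor_map(2)[OF F G] qsup_mor_Dtheta])
  show "qsup_mor (qtensor (Dobj \<alpha>) (Dobj \<beta>)) (Dobj (\<alpha>' \<circledast> \<beta>'))
      (\<lambda>\<phi>. Dmap (\<alpha> \<circledast> \<beta>) (f \<circledast> g) (Dtheta \<alpha> \<beta> \<phi>))"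
    by (rule qsup_mor_comp[OF qsup_mor_Dtheta qsup_mor_Dmap[OF dmor_qprod[OF f g]]])
  fix m n assume m: "m \<in> Obs (Dobj \<alpha>)" and n: "n \<in> Obs (Dobj \<beta>)"
  show "Dtheta \<alpha>' \<beta>' (qtensor_map (Dobj \<alpha>) (Dobj \<beta>) (Dobj \<alpha>') (Dobj \<beta>') (Dmap \<alpha> f) (Dmap \<beta> g)
      (pure_tensor (Dobj \<alpha>) (Dobj \<beta>) m n)) =
    Dmap (\<alpha> \<circledast> \<beta>) (f \<circledast> g) (Dtheta \<alpha> \<beta> (pure_tensor (Dobj \<alpha>) (Dobj \<beta>) m n))"
    using m n by (simp add: qtensor_map(3)[OF F G] Dtheta_pure_tensor Dmap_Dtens[OF f g]
      qsup_mor_in[OF F] qsup_mor_in[OF G])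
qed


section \<open>Complete distributivity of tensor products\<close>

text \<open>
  \<open>T a x\<close> is the Q-valued degree to which \<open>x\<close> is totally below \<open>a\<close>.  The third rule is the
  adjunction of \<open>T\<close> and \<open>S\<close> with the colimit \<open>c\<close> of \<open>L\<close> left anonymous.
\<close>

lemma ccdE:
  assumes "ccd A"
  obtains T where "\<And>a x. a \<in> Obs A \<Longrightarrow> x \<in> Obs A \<Longrightarrow> T a x \<le> Hom A x a"
    and "\<And>a c. a \<in> Obs A \<Longrightarrow> c \<in> Obs A \<Longrightarrow> (INF x\<in>Obs A. T a x \<rightharpoonup> Hom A x c) = Hom A a c"
    and "\<And>L. (\<And>x y. x \<in> Obs A \<Longrightarrow> y \<in> Obs A \<Longrightarrow> L y * Hom A x y \<le> L x) \<Longrightarrow>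
      \<exists>c\<in>Obs A. \<forall>a\<in>Obs A. (INF x\<in>Obs A. T a x \<rightharpoonup> L x) = Hom A a c"
proof -
  let ?P = "presheaves A"
  obtain S T where A: "qcategory A" and S: "adjunction ?P A S (yoneda A)" and T: "adjunction A ?P T S"
    using assms by (auto simp: ccd_def)
  have T_Hom: "(INF x\<in>Obs A. T a x \<rightharpoonup> L x) = Hom A a (S L)" if "a \<in> Obs A" "L \<in> Obs ?P" for a L
    using T that by (simp add: adjunction_def) (simp add: presheaves_def)
  have S_in: "S L \<in> Obs A" if "L \<in> Obs ?P" for L
    using S that by (auto simp: adjunction_def qfunctor_def)
  \<comment> \<open>The colimit of a representable presheaf is isomorphic to its representing
    object; the two directions come from the counit and the unit of the adjunction of
    \<open>S\<close> and \<open>yoneda A\<close>.\<close>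
  have Sy: "Hom A a (S (yoneda A c)) = Hom A a c" if a: "a \<in> Obs A" and c: "c \<in> Obs A" for a c
  proof -
    have Y: "yoneda A c \<in> Obs ?P" by (rule yoneda_in[OF A c])
    note Sc = S_in[OF Y]
    have 1: "1 \<le> Hom A (S (yoneda A c)) c"
      using S Y c qcat_refl[OF qcategory_presheaves Y] by (simp add: adjunction_def)
    have "1 \<le> Hom ?P (yoneda A c) (yoneda A (S (yoneda A c)))"
      using S Y Sc qcat_refl[OF A Sc] by (simp add: adjunction_def)
    then have "Hom A x c \<le> Hom A x (S (yoneda A c))" if "x \<in> Obs A" for x
      using that by (simp add: presheaves_def yoneda_def le_INF_qimp_iff)
    moreover have "1 * Hom A a (S (yoneda A c)) \<le> Hom A a c"
      by (rule order_trans[OF q_mult_mono[OF 1 order_refl] qcat_trans[OF A a Sc c]])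
    ultimately show ?thesis using a by (auto intro: antisym)
  qed
  have cap: "(INF x\<in>Obs A. T a x \<rightharpoonup> Hom A x c) = Hom A a c" if "a \<in> Obs A" "c \<in> Obs A" for a c
    using T_Hom[OF that(1) yoneda_in[OF A that(2)]] Sy[OF that]
    by (simp add: yoneda_def cong: INF_cong)
  \<comment> \<open>Take \<open>c = a\<close> in \<open>cap\<close>: the right-hand side is then
    above the unit.\<close>
  have "T a x \<le> Hom A x a" if a: "a \<in> Obs A" and x: "x \<in> Obs A" for a x
    using cap[OF a a] qcat_refl[OF A a] INF_qimp_mult[OF x, of "T a" "\<lambda>x. Hom A x a"]
    by (metis mult.right_neutral order_trans q_mult_mono_right)
  moreover have "\<exists>c\<in>Obs A. \<forall>a\<in>Obs A. (INF x\<in>Obs A. T a x \<rightharpoonup> L x) = Hom A a c"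
    if L: "\<And>x y. x \<in> Obs A \<Longrightarrow> y \<in> Obs A \<Longrightarrow> L y * Hom A x y \<le> L x" for L
  proof -
    have "restrict L (Obs A) \<in> Obs ?P" using L by (simp add: presheaves_def)
    then show ?thesis using T_Hom[of _ "restrict L (Obs A)"] S_in by (auto cong: INF_cong)
  qed
  ultimately show thesis using cap that by blast
qed

section \<open>Iterated weighted infima\<close>

text \<open>Residuation curries, so an infimum with product weights can be taken one variable at a
  time, here with the first variable outermost.\<close>

lemma INF_qimp_INF:
  "(INF x\<in>X. f x \<rightharpoonup> (INF y\<in>Y. g y \<rightharpoonup> h x y)) =
    (INF p\<in>X \<times> Y. f (fst p) * g (snd p) \<rightharpoonup> (h (fst p) (snd p) :: 'q::comm_unital_quantale))"
  by (rule eq_of_le_iff) (auto simp: le_INF_qimp_iff ac_simps)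

text \<open>The two orders of nesting are needed for representability in either variable.\<close>

lemma INF_qimp_INF':
  "(INF y\<in>Y. g y \<rightharpoonup> (INF x\<in>X. f x \<rightharpoonup> h x y)) =
    (INF p\<in>X \<times> Y. f (fst p) * g (snd p) \<rightharpoonup> (h (fst p) (snd p) :: 'q::comm_unital_quantale))"
  by (rule eq_of_le_iff) (auto simp: le_INF_qimp_iff ac_simps)

text \<open>A factor \<open>c\<close> moves under the weighted infimum. With \<open>c\<close> a hom
  value, this shows that averaging a family of presheaves over a second variable gives a presheaf
  again.\<close>

lemma mult_INF_qimp_le:
  assumes "\<And>i. i \<in> I \<Longrightarrow> L i * c \<le> L' i"
  shows "(INF i\<in>I. w i \<rightharpoonup> L i) * c \<le> (INF i\<in>I. w i \<rightharpoonup> (L' i :: 'q::comm_unital_quantale))"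
  unfolding le_INF_qimp_iff
proof
  fix i assume i: "i \<in> I"
  have "w i * ((INF i\<in>I. w i \<rightharpoonup> L i) * c) \<le> L i * c"
    unfolding mult.assoc[symmetric] by (intro q_mult_mono INF_qimp_mult i order_refl)
  then show "w i * ((INF i\<in>I. w i \<rightharpoonup> L i) * c) \<le> L' i" using assms[OF i] by (rule order_trans)
qed

section \<open>The two adjunctions for the tensor product\<close>

text \<open>Both adjunctions are verified for one explicit \<open>S\<close>, which samples a
  presheaf only at pure tensors; this is enough because \<open>w\<close> reproduces every element of
  the tensor product.\<close>

lemma ccd_qtensor:
  fixes A :: "('a, 'q::comm_unital_quantale) qcat" and B :: "('b, 'q) qcat"
  assumes A: "qsup_object A" "ccd A" and B: "qsup_object B" "ccd B"
  shows "ccd (qtensor A B)"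
proof -
  let ?T = "qtensor A B" and ?I = "Obs A \<times> Obs B" and ?P = "presheaves (qtensor A B)"
  let ?t = "\<lambda>p. pure_tensor A B (fst p) (snd p)"
  obtain TA where TA: "\<And>a x. a \<in> Obs A \<Longrightarrow> x \<in> Obs A \<Longrightarrow> TA a x \<le> Hom A x a"
    "\<And>a c. a \<in> Obs A \<Longrightarrow> c \<in> Obs A \<Longrightarrow> (INF x\<in>Obs A. TA a x \<rightharpoonup> Hom A x c) = Hom A a c"
    "\<And>L. (\<And>x y. x \<in> Obs A \<Longrightarrow> y \<in> Obs A \<Longrightarrow> L y * Hom A x y \<le> L x) \<Longrightarrow>
      \<exists>c\<in>Obs A. \<forall>a\<in>Obs A. (INF x\<in>Obs A. TA a x \<rightharpoonup> L x) = Hom A a c"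
    using ccdE[OF A(2)] by blast
  obtain TB where TB: "\<And>a x. a \<in> Obs B \<Longrightarrow> x \<in> Obs B \<Longrightarrow> TB a x \<le> Hom B x a"
    "\<And>a c. a \<in> Obs B \<Longrightarrow> c \<in> Obs B \<Longrightarrow> (INF x\<in>Obs B. TB a x \<rightharpoonup> Hom B x c) = Hom B a c"
    "\<And>L. (\<And>x y. x \<in> Obs B \<Longrightarrow> y \<in> Obs B \<Longrightarrow> L y * Hom B x y \<le> L x) \<Longrightarrow>
      \<exists>c\<in>Obs B. \<forall>a\<in>Obs B. (INF x\<in>Obs B. TB a x \<rightharpoonup> L x) = Hom B a c"
    using ccdE[OF B(2)] by blast
  have t_in: "?t p \<in> Obs ?T" for p by (rule pure_tensor_in[OF A(1) B(1)])
  have Hom_t: "Hom ?T (?t p) \<phi> = \<phi> p" if "p \<in> ?I" "\<phi> \<in> Obs ?T" for p \<phi>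
    using that Hom_pure_tensor[OF A(1) B(1)] by auto
  define w where "w p s = TA (fst p) (fst s) * TB (snd p) (snd s)" for p s
  \<comment> \<open>An element of the tensor product is representable in each variable, so
    \<open>TB\<close> reproduces it in the second variable and then \<open>TA\<close> in the
    first.\<close>
  have w_INF: "(INF s\<in>?I. w p s \<rightharpoonup> \<psi> s) = \<psi> p" if \<psi>: "\<psi> \<in> Obs ?T" and p: "p \<in> ?I" for \<psi> p
  proof -
    obtain a b where ab: "p = (a, b)" "a \<in> Obs A" "b \<in> Obs B" using p by auto
    obtain c where c: "c \<in> Obs A" "\<And>a. a \<in> Obs A \<Longrightarrow> \<psi> (a, b) = Hom A a c"
      using \<psi> ab by (auto simp: qtensor_def)
    have inner: "(INF y\<in>Obs B. TB b y \<rightharpoonup> \<psi> (x, y)) = \<psi> (x, b)" if x: "x \<in> Obs A" for x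
    proof -
      obtain d where d: "d \<in> Obs B" "\<And>b. b \<in> Obs B \<Longrightarrow> \<psi> (x, b) = Hom B b d"
        using \<psi> x by (auto simp: qtensor_def)
      then show ?thesis using TB(2)[OF ab(3) d(1)] ab by (simp cong: INF_cong)
    qed
    have "(INF s\<in>?I. w p s \<rightharpoonup> \<psi> s) = (INF x\<in>Obs A. TA a x \<rightharpoonup> (INF y\<in>Obs B. TB b y \<rightharpoonup> \<psi> (x, y)))"
      by (simp add: INF_qimp_INF w_def ab)
    also have "\<dots> = \<psi> (a, b)"
      using TA(2)[OF ab(2) c(1)] ab(2) c(2) by (simp add: inner cong: INF_cong)
    finally show ?thesis using ab by simp
  qed
  have w_le: "\<psi> p * w p s \<le> \<psi> s" if \<psi>: "\<psi> \<in> Obs ?T" and p: "p \<in> ?I" and s: "s \<in> ?I" for \<psi> p s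
    using INF_qimp_mult[OF s, of "w p" \<psi>] w_INF[OF \<psi> p] by (simp add: mult.commute)
  define S where "S \<Lambda> = (\<lambda>p\<in>?I. INF s\<in>?I. w p s \<rightharpoonup> \<Lambda> (?t s))" for \<Lambda> :: "('a \<times> 'b \<Rightarrow> 'q) \<Rightarrow> 'q"
  have bi: "bimorphism A B ?T (pure_tensor A B)" by (rule bimorphism_pure_tensor[OF A(1) B(1)])
  \<comment> \<open>Pure tensors are functorial in each variable, so \<Lambda> on them is a presheaf
    in each variable separately. Averaging over one variable keeps that, and the third property of
    \<open>TA\<close> or \<open>TB\<close> yields the representing object in the other.\<close>
  have S_in: "S \<Lambda> \<in> Obs ?T" if \<Lambda>: "\<Lambda> \<in> Obs ?P" for \<Lambda>
  proof -
    have \<Lambda>le: "\<Lambda> \<psi> * Hom ?T \<phi> \<psi> \<le> \<Lambda> \<phi>" if "\<phi> \<in> Obs ?T" "\<psi> \<in> Obs ?T" for \<phi> \<psi>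
      using \<Lambda> that by (simp add: presheaves_def)
    have \<Lambda>A: "\<Lambda> (pure_tensor A B y b) * Hom A x y \<le> \<Lambda> (pure_tensor A B x b)"
      if "x \<in> Obs A" "y \<in> Obs A" "b \<in> Obs B" for x y b
    proof -
      have "Hom A x y \<le> Hom ?T (pure_tensor A B x b) (pure_tensor A B y b)"
        using bi that by (auto simp: bimorphism_def qsup_mor_def adjunction_def qfunctor_def)
      from order_trans[OF q_mult_mono_right[OF this] \<Lambda>le[OF t_in[of "(x, b)"] t_in[of "(y, b)"], simplified]]
      show ?thesis .
    qed
    have \<Lambda>B: "\<Lambda> (pure_tensor A B a y) * Hom B x y \<le> \<Lambda> (pure_tensor A B a x)"
      if "x \<in> Obs B" "y \<in> Obs B" "a \<in> Obs A" for x y a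
    proof -
      have "Hom B x y \<le> Hom ?T (pure_tensor A B a x) (pure_tensor A B a y)"
        using bi that by (auto simp: bimorphism_def qsup_mor_def adjunction_def qfunctor_def)
      from order_trans[OF q_mult_mono_right[OF this] \<Lambda>le[OF t_in[of "(a, x)"] t_in[of "(a, y)"], simplified]]
      show ?thesis .
    qed
    have "\<exists>c\<in>Obs A. \<forall>a\<in>Obs A. (INF s\<in>?I. w (a, b) s \<rightharpoonup> \<Lambda> (?t s)) = Hom A a c"
      if b: "b \<in> Obs B" for b
      using TA(3)[of "\<lambda>x. INF y\<in>Obs B. TB b y \<rightharpoonup> \<Lambda> (pure_tensor A B x y)"]
      by (simp add: INF_qimp_INF w_def mult_INF_qimp_le \<Lambda>A)
    moreover have "\<exists>c\<in>Obs B. \<forall>b\<in>Obs B. (INF s\<in>?I. w (a, b) s \<rightharpoonup> \<Lambda> (?t s)) = Hom B b c"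
      if a: "a \<in> Obs A" for a
      using TB(3)[of "\<lambda>y. INF x\<in>Obs A. TA a x \<rightharpoonup> \<Lambda> (pure_tensor A B x y)"]
      by (simp add: INF_qimp_INF' w_def mult_INF_qimp_le \<Lambda>B)
    ultimately show ?thesis by (simp add: qtensor_def S_def)
  qed
  have "adjunction ?P ?T S (yoneda ?T)"
  proof (rule adjunctionI[OF qcategory_presheaves qcategory_qtensor])
    fix \<Lambda> \<chi> assume \<Lambda>: "\<Lambda> \<in> Obs ?P" and \<chi>: "\<chi> \<in> Obs ?T"
    have yon: "Hom ?P \<Lambda> (yoneda ?T \<chi>) = (INF \<psi>\<in>Obs ?T. \<Lambda> \<psi> \<rightharpoonup> Hom ?T \<psi> \<chi>)"
      by (simp add: presheaves_def yoneda_def cong: INF_cong)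
    let ?r = "INF \<psi>\<in>Obs ?T. \<Lambda> \<psi> \<rightharpoonup> Hom ?T \<psi> \<chi>"
    show "Hom ?T (S \<Lambda>) \<chi> = Hom ?P \<Lambda> (yoneda ?T \<chi>)"
      unfolding yon
    proof (rule antisym)
      \<comment> \<open>The unit of the adjunction in pointwise form. Since
        \<open>Hom ?T (?t s) \<psi>\<close> is \<open>\<psi> s\<close>, the presheaf law bounds
        \<open>\<Lambda> \<psi> * \<psi> s\<close> by \<open>\<Lambda> (?t s)\<close>, and
        \<open>w_le\<close> supplies the bound on \<open>\<psi> p * w p s\<close>.\<close>
      have le_S: "\<Lambda> \<psi> \<le> Hom ?T \<psi> (S \<Lambda>)" if \<psi>: "\<psi> \<in> Obs ?T" for \<psi>
      proof -
        have "w p s * (\<psi> p * \<Lambda> \<psi>) \<le> \<Lambda> (?t s)" if p: "p \<in> ?I" and s: "s \<in> ?I" for p s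
        proof -
          have "w p s * (\<psi> p * \<Lambda> \<psi>) = \<Lambda> \<psi> * (\<psi> p * w p s)" by (simp add: ac_simps)
          also have "\<dots> \<le> \<Lambda> \<psi> * Hom ?T (?t s) \<psi>"
            unfolding Hom_t[OF s \<psi>] by (rule q_mult_mono_right[OF w_le[OF \<psi> p s]])
          also have "\<dots> \<le> \<Lambda> (?t s)" using \<Lambda> \<psi> t_in[of s] by (simp add: presheaves_def)
          finally show ?thesis .
        qed
        then have "\<psi> p * \<Lambda> \<psi> \<le> S \<Lambda> p" if "p \<in> ?I" for p
          using that by (simp add: S_def le_INF_qimp_iff)
        then show ?thesis by (simp add: qtensor_def le_INF_qimp_iff)
      qed
      have "\<Lambda> \<psi> * Hom ?T (S \<Lambda>) \<chi> \<le> Hom ?T \<psi> \<chi>" if \<psi>: "\<psi> \<in> Obs ?T" for \<psi>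
      proof -
        have "\<Lambda> \<psi> * Hom ?T (S \<Lambda>) \<chi> \<le> Hom ?T (S \<Lambda>) \<chi> * Hom ?T \<psi> (S \<Lambda>)"
          by (subst mult.commute) (rule q_mult_mono_right[OF le_S[OF \<psi>]])
        also have "\<dots> \<le> Hom ?T \<psi> \<chi>" by (rule qcat_trans[OF qcategory_qtensor \<psi> S_in[OF \<Lambda>] \<chi>])
        finally show ?thesis .
      qed
      then show "Hom ?T (S \<Lambda>) \<chi> \<le> ?r" by (simp add: le_INF_qimp_iff)
      \<comment> \<open>Conversely, \<open>?r\<close> carries each \<open>\<Lambda> (?t s)\<close>
        into \<open>\<chi> s\<close>, and the \<open>w\<close>-weighted infimum of \<chi> is \<chi>
        itself.\<close>
      have "S \<Lambda> p * ?r \<le> \<chi> p" if p: "p \<in> ?I" for p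
      proof -
        have "\<Lambda> (?t s) * ?r \<le> \<chi> s" if "s \<in> ?I" for s
          using INF_qimp_mult[OF t_in[of s], of \<Lambda> "\<lambda>\<psi>. Hom ?T \<psi> \<chi>"] Hom_t[OF that \<chi>] by simp
        then have "(INF s\<in>?I. w p s \<rightharpoonup> \<Lambda> (?t s)) * ?r \<le> (INF s\<in>?I. w p s \<rightharpoonup> \<chi> s)"
          by (rule mult_INF_qimp_le)
        then show ?thesis using p by (simp add: S_def w_INF[OF \<chi> p])
      qed
      then show "?r \<le> Hom ?T (S \<Lambda>) \<chi>" by (simp add: qtensor_def le_INF_qimp_iff)
    qed
  qed (auto simp: S_in yoneda_in[OF qcategory_qtensor])
  moreover
  \<comment> \<open>The left adjoint of \<open>S\<close>: \<open>R \<phi>\<close> is the presheaf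
    generated by the representables at the pure tensors \<open>?t s\<close>, with weight the join of
    \<open>\<phi> p * w p s\<close> over \<open>p\<close>.\<close>
  define R where "R \<phi> = (\<lambda>\<psi>\<in>Obs ?T. SUP p\<in>?I. SUP s\<in>?I. \<phi> p * w p s * Hom ?T \<psi> (?t s))" for \<phi>
  have R_in: "R \<phi> \<in> Obs ?P" for \<phi>
  proof -
    have "R \<phi> \<psi> * Hom ?T \<chi> \<psi> \<le> R \<phi> \<chi>" if \<psi>: "\<psi> \<in> Obs ?T" and \<chi>: "\<chi> \<in> Obs ?T" for \<psi> \<chi>
    proof -
      have "\<phi> p * w p s * Hom ?T \<psi> (?t s) * Hom ?T \<chi> \<psi> \<le> R \<phi> \<chi>" if p: "p \<in> ?I" and s: "s \<in> ?I" for p s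
      proof -
        have "\<phi> p * w p s * Hom ?T \<psi> (?t s) * Hom ?T \<chi> \<psi> \<le> \<phi> p * w p s * Hom ?T \<chi> (?t s)"
          unfolding mult.assoc[of _ "Hom ?T \<psi> (?t s)"]
          by (rule q_mult_mono_right[OF qcat_trans[OF qcategory_qtensor \<chi> \<psi> t_in]])
        also have "\<dots> \<le> R \<phi> \<chi>"
          unfolding R_def restrict_apply'[OF \<chi>]
          by (rule order_trans[OF _ SUP_upper[OF p]], rule SUP_upper[OF s])
        finally show ?thesis .
      qed
      then show ?thesis
        unfolding R_def[of \<phi>, THEN fun_cong, of \<psi>] restrict_apply'[OF \<psi>] SUP_mult_le_iff by blast
    qed
    then show ?thesis by (simp add: presheaves_def R_def)
  qed
  have "adjunction ?T ?P R S"
  proof (rule adjunctionI[OF qcategory_qtensor qcategory_presheaves])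
    fix \<phi> \<Lambda> assume \<phi>: "\<phi> \<in> Obs ?T" and \<Lambda>: "\<Lambda> \<in> Obs ?P"
    show "Hom ?P (R \<phi>) \<Lambda> = Hom ?T \<phi> (S \<Lambda>)"
    proof (rule eq_of_le_iff)
      fix q
      \<comment> \<open>The Yoneda argument: a condition on all \<open>\<psi>\<close> weighted by
        the representable at \<open>?t s\<close> reduces to its instance at
        \<open>?t s\<close>.\<close>
      have yon: "(\<forall>\<psi>\<in>Obs ?T. c * Hom ?T \<psi> (?t s) * q \<le> \<Lambda> \<psi>) \<longleftrightarrow> c * q \<le> \<Lambda> (?t s)" for c s
      proof
        assume "\<forall>\<psi>\<in>Obs ?T. c * Hom ?T \<psi> (?t s) * q \<le> \<Lambda> \<psi>"
        then have "c * Hom ?T (?t s) (?t s) * q \<le> \<Lambda> (?t s)" using t_in by blast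
        moreover have "c * 1 * q \<le> c * Hom ?T (?t s) (?t s) * q"
          by (intro q_mult_mono order_refl qcat_refl[OF qcategory_qtensor t_in])
        ultimately show "c * q \<le> \<Lambda> (?t s)" by simp
      next
        assume le: "c * q \<le> \<Lambda> (?t s)"
        show "\<forall>\<psi>\<in>Obs ?T. c * Hom ?T \<psi> (?t s) * q \<le> \<Lambda> \<psi>"
        proof
          fix \<psi> assume \<psi>: "\<psi> \<in> Obs ?T"
          have "c * Hom ?T \<psi> (?t s) * q = c * q * Hom ?T \<psi> (?t s)" by (simp add: ac_simps)
          also have "\<dots> \<le> \<Lambda> (?t s) * Hom ?T \<psi> (?t s)" by (rule q_mult_mono[OF le order_refl])
          also have "\<dots> \<le> \<Lambda> \<psi>" using \<Lambda> \<psi> t_in[of s] by (simp add: presheaves_def)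
          finally show "c * Hom ?T \<psi> (?t s) * q \<le> \<Lambda> \<psi>" .
        qed
      qed
      have "q \<le> Hom ?P (R \<phi>) \<Lambda> \<longleftrightarrow> (\<forall>\<psi>\<in>Obs ?T. R \<phi> \<psi> * q \<le> \<Lambda> \<psi>)"
        by (simp add: presheaves_def le_INF_qimp_iff)
      also have "\<dots> \<longleftrightarrow>
          (\<forall>\<psi>\<in>Obs ?T. \<forall>p\<in>?I. \<forall>s\<in>?I. \<phi> p * w p s * Hom ?T \<psi> (?t s) * q \<le> \<Lambda> \<psi>)"
        unfolding R_def by (simp only: restrict_apply' SUP_mult_le_iff cong: ball_cong)
      also have "\<dots> \<longleftrightarrow> (\<forall>p\<in>?I. \<forall>s\<in>?I. \<phi> p * w p s * q \<le> \<Lambda> (?t s))"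
        (is "?l \<longleftrightarrow> ?r")
      proof -
        have "?l \<longleftrightarrow> (\<forall>p\<in>?I. \<forall>s\<in>?I. \<forall>\<psi>\<in>Obs ?T. \<phi> p * w p s * Hom ?T \<psi> (?t s) * q \<le> \<Lambda> \<psi>)"
          by blast
        also have "\<dots> \<longleftrightarrow> ?r" by (simp only: yon)
        finally show ?thesis .
      qed
      also have "\<dots> \<longleftrightarrow> (\<forall>p\<in>?I. \<forall>s\<in>?I. w p s * (\<phi> p * q) \<le> \<Lambda> (?t s))"
        by (simp only: ac_simps)
      also have "\<dots> \<longleftrightarrow> (\<forall>p\<in>?I. \<phi> p * q \<le> S \<Lambda> p)"
        unfolding S_def by (simp only: restrict_apply' le_INF_qimp_iff cong: ball_cong)
      also have "\<dots> \<longleftrightarrow> q \<le> Hom ?T \<phi> (S \<Lambda>)"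
        by (simp add: qtensor_def le_INF_qimp_iff)
      finally show "q \<le> Hom ?P (R \<phi>) \<Lambda> \<longleftrightarrow> q \<le> Hom ?T \<phi> (S \<Lambda>)" .
    qed
  qed (auto simp: S_in R_in)
  ultimately show ?thesis using qcategory_qtensor unfolding ccd_def by blast
qed

theorem theorem5p10:
  shows "(\<exists>\<theta> :: ('x, 'y, 'q::comm_unital_quantale) qrel \<Rightarrow> ('u, 'v, 'q) qrel \<Rightarrow>
              (('x, unit, 'q) qrel \<times> ('u, unit, 'q) qrel \<Rightarrow> 'q) \<Rightarrow> ('x \<times> 'u, unit, 'q) qrel.
            (\<forall>\<alpha> \<beta>. regular \<alpha> \<and> regular \<beta> \<longrightarrow>
               qsup_iso (qtensor (Dobj \<alpha>) (Dobj \<beta>)) (Dobj (\<alpha> \<circledast> \<beta>)) (\<theta> \<alpha> \<beta>)) \<and>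
            (\<forall>\<alpha> \<alpha>' \<beta> \<beta>' f g.
               regular \<alpha> \<and> regular \<alpha>' \<and> regular \<beta> \<and> regular \<beta>' \<and>
               dmor f \<alpha>' \<alpha> \<and> dmor g \<beta>' \<beta> \<longrightarrow>
               (\<forall>\<phi>\<in>Obs (qtensor (Dobj \<alpha>) (Dobj \<beta>)).
                  \<theta> \<alpha>' \<beta>' (qtensor_map (Dobj \<alpha>) (Dobj \<beta>) (Dobj \<alpha>') (Dobj \<beta>')
                              (Dmap \<alpha> f) (Dmap \<beta> g) \<phi>)
                    = Dmap (\<alpha> \<circledast> \<beta>) (f \<circledast> g) (\<theta> \<alpha> \<beta> \<phi>))))
       \<and> (\<forall>(A :: ('a, 'q) qcat) (B :: ('b, 'q) qcat).
            qsup_object A \<and> ccd A \<and> qsup_object B \<and> ccd B \<longrightarrow> ccd (qtensor A B))"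
proof (intro conjI exI[of _ Dtheta] allI impI)
  show "ccd (qtensor A B)" if "qsup_object A \<and> ccd A \<and> qsup_object B \<and> ccd B"
    for A :: "('a, 'q) qcat" and B :: "('b, 'q) qcat"
    using that by (intro ccd_qtensor) auto
qed (use qsup_iso_Dtheta Dtheta_natural in blast)+

end
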